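(* Let $b$ be a braid word representing an element of the commutator subgroup $[B_n,B_n]$, i.e. a product of simple commutators. Given an efficient algorithm $\mathcal A(w)$ which writes any word representative $w$ of an element of $S_n$ in canonical form, there exists an efficient algorithm which expresses $b$ as the product of a pure braid and a simple commutator of permutation braids.
   Context: $B_n$ is the braid group with generators $\sigma_1,\dots,\sigma_{n-1}$ and relations $\sigma_i\sigma_j=\sigma_j\sigma_i$ for $|i-j|\ge 2$ and $\sigma_i\sigma_{i+1}\sigma_i=\sigma_{i+1}\sigma_i\sigma_{i+1}$. A braid word is a word in the $\sigma_i^{\pm1}$. A simple commutator is an element $[x,y]=xyx^{-1}y^{-1}$. A permutation braid is a positive braid (representable using only the $\sigma_i$, no inverses) in which no two strands cross twice; $D_n$ is the set of permutation braids, and a simple commutator of permutation braids is $[d_1,d_2]$ with $d_1,d_2\in D_n$. The homomorphism $\rho:B_n\to S_n$ sends $\sigma_i$ to $\tau_i=(i,i+1)$; a pure braid is an element of $\ker\rho$. Order words in $1<2<\dots<n-1$ (with $i$ standing for $\tau_i$) by ShortLex: shorter words are smaller, and words of equal length are compared lexicographically. The canonical form of an element of $S_n$ is the ShortLex-least word in the $\tau_i$ representing it. An algorithm taking $n$ and a word of length $k$ as input is called efficient if it runs in time polynomial in $n$ for fixed $k$ and in time polynomial in $k$ for fixed $n$. *)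

theory Defs
  imports
    "HOL-Algebra.Sym_Groups"
    "HOL-Computational_Algebra.Polynomial"
begin

section \<open>Words for elements of the symmetric group\<close>

text \<open>The number \<open>i\<close> stands for \<open>\<tau>\<^sub>i = (i, i+1)\<close>.\<close>

definition perm_words :: "nat \<Rightarrow> nat list set" where
  "perm_words n = lists {1..<n}"

fun word_perm :: "nat list \<Rightarrow> nat \<Rightarrow> nat" where
  "word_perm [] = id"
| "word_perm (i # w) = transpose i (Suc i) \<circ> word_perm w"

definition canonical_form :: "nat \<Rightarrow> (nat \<Rightarrow> nat) \<Rightarrow> nat list \<Rightarrow> bool" where
  "canonical_form n s w \<longleftrightarrow> w \<in> perm_words n \<and> word_perm w = s \<and>
     (\<forall>v \<in> perm_words n. word_perm v = s \<longrightarrow> v = w \<or> (w, v) \<in> lenlex less_than)"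


section \<open>Braid groups\<close>

datatype letter = Gen (index: nat) | GenInv (index: nat)

definition braid_words :: "nat \<Rightarrow> letter list set" where
  "braid_words n = {w. index ` set w \<subseteq> {1..<n}}"

inductive braid_step :: "nat \<Rightarrow> letter list \<Rightarrow> letter list \<Rightarrow> bool" for n where
  cancel_right: "i \<in> {1..<n} \<Longrightarrow> braid_step n (u @ [Gen i, GenInv i] @ v) (u @ v)"
| cancel_left: "i \<in> {1..<n} \<Longrightarrow> braid_step n (u @ [GenInv i, Gen i] @ v) (u @ v)"
| far: "\<lbrakk>i \<in> {1..<n}; j \<in> {1..<n}; i + 2 \<le> j\<rbrakk>
    \<Longrightarrow> braid_step n (u @ [Gen i, Gen j] @ v) (u @ [Gen j, Gen i] @ v)"
| braid: "\<lbrakk>i \<in> {1..<n}; Suc i \<in> {1..<n}\<rbrakk>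
    \<Longrightarrow> braid_step n (u @ [Gen i, Gen (Suc i), Gen i] @ v)
                     (u @ [Gen (Suc i), Gen i, Gen (Suc i)] @ v)"

text \<open>The element of \<open>B\<^sub>n\<close> represented by a word, as an equivalence class of words.\<close>

definition braid_of :: "nat \<Rightarrow> letter list \<Rightarrow> letter list set" where
  "braid_of n w = {v. equivclp (braid_step n) w v}"

definition braid_group :: "nat \<Rightarrow> letter list set monoid" where
  "braid_group n = \<lparr>
     carrier = braid_of n ` braid_words n,
     mult = (\<lambda>X Y. \<Union>x\<in>X. \<Union>y\<in>Y. braid_of n (x @ y)),
     one = braid_of n []\<rparr>"

text \<open>The homomorphism \<open>\<rho>\<close> sends the class of a word to the common permutation of its members.\<close>

definition braid_perm :: "letter list set \<Rightarrow> nat \<Rightarrow> nat" where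
  "braid_perm X = the_elem ((\<lambda>w. word_perm (map index w)) ` X)"

definition pure_braids :: "nat \<Rightarrow> letter list set set" where
  "pure_braids n = kernel (braid_group n) (sym_group n) braid_perm"

text \<open>
  Strands are named by their initial positions. When reading a positive word, \<open>p j\<close> is
  the strand currently in position \<open>j\<close>; the letter \<open>i\<close> lets the strands in
  positions \<open>i\<close> and \<open>i + 1\<close> cross. The result lists the crossing pairs in order.
\<close>

fun crossing_pairs :: "(nat \<Rightarrow> nat) \<Rightarrow> nat list \<Rightarrow> nat set list" where
  "crossing_pairs p [] = []"
| "crossing_pairs p (i # w) = {p i, p (Suc i)} # crossing_pairs (p \<circ> transpose i (Suc i)) w"

definition permutation_braids :: "nat \<Rightarrow> letter list set set" where
  "permutation_braids n =
     {braid_of n (map Gen w) | w. w \<in> perm_words n \<and> distinct (crossing_pairs id w)}"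

definition simple_commutator :: "('a, 'b) monoid_scheme \<Rightarrow> 'a \<Rightarrow> 'a \<Rightarrow> 'a" where
  "simple_commutator G x y = x \<otimes>\<^bsub>G\<^esub> y \<otimes>\<^bsub>G\<^esub> inv\<^bsub>G\<^esub> x \<otimes>\<^bsub>G\<^esub> inv\<^bsub>G\<^esub> y"

definition commutator_words :: "nat \<Rightarrow> letter list set" where
  "commutator_words n =
     {w \<in> braid_words n. braid_of n w \<in> derived (braid_group n) (carrier (braid_group n))}"


section \<open>Algorithms and running time\<close>

text \<open>
  Algorithms are while programs over pairing structures (S-expressions) whose atoms are
  natural numbers. One step is charged for each assignment and each evaluation of
  a condition. Each of these costs constant time on a pointer machine: expressions are a fixed
  part of the program, pairs are passed by reference, comparison inspects atoms only,
  and there is no multiplication. Hence time agrees up to a polynomial with time on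
  random access machines with addition and subtraction and on Turing machines.
\<close>

datatype val = Atom nat | Pair val val

type_synonym vname = string
type_synonym state = "vname \<Rightarrow> val"

datatype expr =
    Var vname
  | Const nat
  | MkPair expr expr
  | Fst expr
  | Snd expr
  | Add expr expr
  | Sub expr expr
  | Less expr expr

fun atom_of :: "val \<Rightarrow> nat" where
  "atom_of (Atom m) = m"
| "atom_of (Pair x y) = 0"

fun fst_of :: "val \<Rightarrow> val" where
  "fst_of (Atom m) = Atom 0"
| "fst_of (Pair x y) = x"

fun snd_of :: "val \<Rightarrow> val" where
  "snd_of (Atom m) = Atom 0"
| "snd_of (Pair x y) = y"

fun expr_val :: "expr \<Rightarrow> state \<Rightarrow> val" where
  "expr_val (Var x) s = s x"
| "expr_val (Const m) s = Atom m"
| "expr_val (MkPair a b) s = Pair (expr_val a s) (expr_val b s)"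
| "expr_val (Fst a) s = fst_of (expr_val a s)"
| "expr_val (Snd a) s = snd_of (expr_val a s)"
| "expr_val (Add a b) s = Atom (atom_of (expr_val a s) + atom_of (expr_val b s))"
| "expr_val (Sub a b) s = Atom (atom_of (expr_val a s) - atom_of (expr_val b s))"
| "expr_val (Less a b) s =
     Atom (if atom_of (expr_val a s) < atom_of (expr_val b s) then 1 else 0)"

datatype com =
    Skip
  | Assign vname expr
  | Seq com com
  | If expr com com
  | While expr com

text \<open>\<open>exec c s t s'\<close>: started in \<open>s\<close>, the program \<open>c\<close> halts in \<open>s'\<close> after \<open>t\<close> steps.
  As a condition, every value except \<open>Atom 0\<close> counts as true.\<close>

inductive exec :: "com \<Rightarrow> state \<Rightarrow> nat \<Rightarrow> state \<Rightarrow> bool" where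
  Skip: "exec Skip s 1 s"
| Assign: "exec (Assign x a) s 1 (s(x := expr_val a s))"
| Seq: "\<lbrakk>exec c\<^sub>1 s t\<^sub>1 s'; exec c\<^sub>2 s' t\<^sub>2 s''\<rbrakk> \<Longrightarrow> exec (Seq c\<^sub>1 c\<^sub>2) s (t\<^sub>1 + t\<^sub>2) s''"
| IfTrue: "\<lbrakk>expr_val a s \<noteq> Atom 0; exec c\<^sub>1 s t s'\<rbrakk> \<Longrightarrow> exec (If a c\<^sub>1 c\<^sub>2) s (t + 1) s'"
| IfFalse: "\<lbrakk>expr_val a s = Atom 0; exec c\<^sub>2 s t s'\<rbrakk> \<Longrightarrow> exec (If a c\<^sub>1 c\<^sub>2) s (t + 1) s'"
| WhileFalse: "expr_val a s = Atom 0 \<Longrightarrow> exec (While a c) s 1 s"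
| WhileTrue: "\<lbrakk>expr_val a s \<noteq> Atom 0; exec c s t\<^sub>1 s'; exec (While a c) s' t\<^sub>2 s''\<rbrakk>
    \<Longrightarrow> exec (While a c) s (t\<^sub>1 + t\<^sub>2 + 1) s''"

fun list_val :: "('a \<Rightarrow> val) \<Rightarrow> 'a list \<Rightarrow> val" where
  "list_val f [] = Atom 0"
| "list_val f (x # xs) = Pair (f x) (list_val f xs)"

fun letter_val :: "letter \<Rightarrow> val" where
  "letter_val (Gen i) = Pair (Atom 0) (Atom i)"
| "letter_val (GenInv i) = Pair (Atom 1) (Atom i)"

abbreviation perm_word_val :: "nat list \<Rightarrow> val" where
  "perm_word_val \<equiv> list_val Atom"

abbreviation braid_word_val :: "letter list \<Rightarrow> val" where
  "braid_word_val \<equiv> list_val letter_val"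

definition input_state :: "nat \<Rightarrow> val \<Rightarrow> state" where
  "input_state n v = (\<lambda>_. Atom 0)(''n'' := Atom n, ''w'' := v)"

definition outputs :: "com \<Rightarrow> nat \<Rightarrow> val \<Rightarrow> val \<Rightarrow> bool" where
  "outputs c n v r \<longleftrightarrow> (\<exists>t s. exec c (input_state n v) t s \<and> s ''out'' = r)"

definition halts_within :: "com \<Rightarrow> nat \<Rightarrow> val \<Rightarrow> nat \<Rightarrow> bool" where
  "halts_within c n v T \<longleftrightarrow> (\<exists>t s. exec c (input_state n v) t s \<and> t \<le> T)"

text \<open>\<open>D n\<close> is the set of words admitted as input together with \<open>n\<close>; \<open>enc\<close> encodes words.\<close>

definition efficient :: "('a list \<Rightarrow> val) \<Rightarrow> (nat \<Rightarrow> 'a list set) \<Rightarrow> com \<Rightarrow> bool" where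
  "efficient enc D c \<longleftrightarrow>
     (\<forall>k. \<exists>p :: nat poly. \<forall>n\<ge>1. \<forall>w\<in>D n. length w = k \<longrightarrow> halts_within c n (enc w) (poly p n)) \<and>
     (\<forall>n\<ge>1. \<exists>q :: nat poly. \<forall>w\<in>D n. halts_within c n (enc w) (poly q (length w)))"


section \<open>The definitions are well formed\<close>

lemma exec_deterministic:
  "exec c s t s' \<Longrightarrow> exec c s u s'' \<Longrightarrow> u = t \<and> s'' = s'"
proof (induction arbitrary: u s'' rule: exec.induct)
  case (Skip s)
  then show ?case by cases auto
next
  case (Assign x a s)
  then show ?case by cases auto
next
  case (Seq c\<^sub>1 s t\<^sub>1 s\<^sub>1 c\<^sub>2 t\<^sub>2 s\<^sub>2)
  from Seq.prems show ?case by cases (use Seq.IH in blast)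
next
  case (IfTrue a s c\<^sub>1 t s' c\<^sub>2)
  from IfTrue.prems show ?case by cases (use IfTrue.hyps IfTrue.IH in blast)+
next
  case (IfFalse a s c\<^sub>2 t s' c\<^sub>1)
  from IfFalse.prems show ?case by cases (use IfFalse.hyps IfFalse.IH in blast)+
next
  case (WhileFalse a s c)
  from WhileFalse.prems show ?case by cases (use WhileFalse.hyps in blast)+
next
  case (WhileTrue a s c t\<^sub>1 s\<^sub>1 t\<^sub>2 s\<^sub>2)
  from WhileTrue.prems show ?case by cases (use WhileTrue.hyps WhileTrue.IH in blast)+
qed

lemma braid_of_eq_iff: "braid_of n u = braid_of n v \<longleftrightarrow> equivclp (braid_step n) u v"
  using equivp_evquivclp[of "braid_step n"] unfolding braid_of_def equivp_def
  by (metis Collect_inj)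

lemma braid_step_context: "braid_step n u v \<Longrightarrow> braid_step n (a @ u @ b) (a @ v @ b)"
proof (induction rule: braid_step.induct)
  case (cancel_right i u v)
  then show ?case using braid_step.cancel_right[of i n "a @ u" "v @ b"] by simp
next
  case (cancel_left i u v)
  then show ?case using braid_step.cancel_left[of i n "a @ u" "v @ b"] by simp
next
  case (far i j u v)
  then show ?case using braid_step.far[of i n j "a @ u" "v @ b"] by simp
next
  case (braid i u v)
  then show ?case using braid_step.braid[of i n "a @ u" "v @ b"] by simp
qed

lemma braid_equiv_context:
  "equivclp (braid_step n) u v \<Longrightarrow> equivclp (braid_step n) (a @ u @ b) (a @ v @ b)"
proof (induction rule: equivclp_induct)
  case (step y z)
  then show ?case by (meson braid_step_context equivclp_into_equivclp)
qed simp

lemma braid_equiv_append: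
  assumes "equivclp (braid_step n) u u'" "equivclp (braid_step n) v v'"
  shows "equivclp (braid_step n) (u @ v) (u' @ v')"
  using braid_equiv_context[OF assms(1), of "[]" v] braid_equiv_context[OF assms(2), of u' "[]"]
  by (auto intro: equivclp_trans)

lemma braid_mult: "braid_of n u \<otimes>\<^bsub>braid_group n\<^esub> braid_of n v = braid_of n (u @ v)"
proof -
  have "braid_of n (x @ y) = braid_of n (u @ v)" if "x \<in> braid_of n u" "y \<in> braid_of n v" for x y
    unfolding braid_of_eq_iff
    by (rule equivclp_sym, rule braid_equiv_append) (use that in \<open>simp_all add: braid_of_def\<close>)
  moreover have "u \<in> braid_of n u" "v \<in> braid_of n v" by (auto simp: braid_of_def)
  ultimately have "(\<Union>x\<in>braid_of n u. \<Union>y\<in>braid_of n v. braid_of n (x @ y)) = braid_of n (u @ v)"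
    by blast
  then show ?thesis by (simp add: braid_group_def)
qed

fun inv_letter :: "letter \<Rightarrow> letter" where
  "inv_letter (Gen i) = GenInv i"
| "inv_letter (GenInv i) = Gen i"

definition inv_word :: "letter list \<Rightarrow> letter list" where
  "inv_word w = rev (map inv_letter w)"

lemma inv_word_left:
  "w \<in> braid_words n \<Longrightarrow> equivclp (braid_step n) (inv_word w @ w) []"
proof (induction w)
  case (Cons x w)
  have "braid_step n (inv_word w @ [inv_letter x, x] @ w) (inv_word w @ w)"
    using Cons.prems braid_step.cancel_left[of _ n "inv_word w" w]
      braid_step.cancel_right[of _ n "inv_word w" w]
    by (cases x) (simp_all add: braid_words_def)
  then have "equivclp (braid_step n) (inv_word (x # w) @ x # w) (inv_word w @ w)"
    by (simp add: inv_word_def r_into_equivclp)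
  moreover have "equivclp (braid_step n) (inv_word w @ w) []"
    using Cons by (simp add: braid_words_def)
  ultimately show ?case by (rule equivclp_trans)
qed (simp add: inv_word_def)

lemma braid_words_append: "u \<in> braid_words n \<Longrightarrow> v \<in> braid_words n \<Longrightarrow> u @ v \<in> braid_words n"
  by (auto simp: braid_words_def)

lemma braid_words_inv:
  assumes "w \<in> braid_words n" shows "inv_word w \<in> braid_words n"
proof -
  have "index (inv_letter x) = index x" for x by (cases x) auto
  then show ?thesis using assms by (auto simp: braid_words_def inv_word_def image_subset_iff)
qed

lemma group_braid_group: "group (braid_group n)"
proof (rule groupI)
  fix X assume "X \<in> carrier (braid_group n)"
  then obtain w where w: "w \<in> braid_words n" "X = braid_of n w" by (auto simp: braid_group_def)
  have "braid_of n (inv_word w) \<otimes>\<^bsub>braid_group n\<^esub> X = \<one>\<^bsub>braid_group n\<^esub>"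
    using inv_word_left[OF w(1)]
    by (simp add: w(2) braid_mult) (simp add: braid_group_def braid_of_eq_iff)
  moreover have "braid_of n (inv_word w) \<in> carrier (braid_group n)"
    using braid_words_inv[OF w(1)] by (simp add: braid_group_def)
  ultimately show "\<exists>Y\<in>carrier (braid_group n). Y \<otimes>\<^bsub>braid_group n\<^esub> X = \<one>\<^bsub>braid_group n\<^esub>"
    by blast
next
  have one: "\<one>\<^bsub>braid_group n\<^esub> = braid_of n []" by (simp add: braid_group_def)
  fix X assume "X \<in> carrier (braid_group n)"
  then obtain w where "X = braid_of n w" by (auto simp: braid_group_def)
  then show "\<one>\<^bsub>braid_group n\<^esub> \<otimes>\<^bsub>braid_group n\<^esub> X = X"
    unfolding one by (simp add: braid_mult)
next
  show "\<one>\<^bsub>braid_group n\<^esub> \<in> carrier (braid_group n)"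
    by (simp add: braid_group_def braid_words_def)
next
  fix X Y assume "X \<in> carrier (braid_group n)" "Y \<in> carrier (braid_group n)"
  then obtain u v where "u \<in> braid_words n" "X = braid_of n u" "v \<in> braid_words n" "Y = braid_of n v"
    by (auto simp: braid_group_def)
  then show "X \<otimes>\<^bsub>braid_group n\<^esub> Y \<in> carrier (braid_group n)"
    by (simp add: braid_mult) (simp add: braid_group_def braid_words_append)
next
  fix X Y Z
  assume "X \<in> carrier (braid_group n)" "Y \<in> carrier (braid_group n)" "Z \<in> carrier (braid_group n)"
  then obtain u v w where "X = braid_of n u" "Y = braid_of n v" "Z = braid_of n w"
    by (auto simp: braid_group_def)
  then show "X \<otimes>\<^bsub>braid_group n\<^esub> Y \<otimes>\<^bsub>braid_group n\<^esub> Z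
      = X \<otimes>\<^bsub>braid_group n\<^esub> (Y \<otimes>\<^bsub>braid_group n\<^esub> Z)"
    by (simp add: braid_mult)
qed

lemma word_perm_append: "word_perm (u @ v) = word_perm u \<circ> word_perm v"
  by (induction u) (auto simp: o_assoc)

lemma word_perm_permutes: "w \<in> perm_words n \<Longrightarrow> word_perm w permutes {1..n}"
proof (induction w)
  case Nil
  then show ?case by (metis permutes_id word_perm.simps(1))
next
  case (Cons i w)
  then have "transpose i (Suc i) permutes {1..n}" "word_perm w permutes {1..n}"
    by (auto simp: perm_words_def intro!: permutes_swap_id)
  then show ?case by (simp only: word_perm.simps permutes_compose)
qed

lemma braid_step_word_perm:
  "braid_step n u v \<Longrightarrow> word_perm (map index u) = word_perm (map index v)"
proof (induction rule: braid_step.induct)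
  case (far i j u v)
  then have "word_perm [i, j] = word_perm [j, i]"
    by (auto simp: fun_eq_iff transpose_def)
  then show ?case by (simp only: map_append list.map letter.sel word_perm_append)
next
  case (braid i u v)
  have "word_perm [i, Suc i, i] = word_perm [Suc i, i, Suc i]"
    by (auto simp: fun_eq_iff transpose_def)
  then show ?case by (simp only: map_append list.map letter.sel word_perm_append)
qed (auto simp: word_perm_append fun_eq_iff)

lemma braid_perm_braid_of: "braid_perm (braid_of n w) = word_perm (map index w)"
proof -
  have "word_perm (map index v) = word_perm (map index w)"
    if "equivclp (braid_step n) w v" for v
    using that by (induction rule: equivclp_induct) (auto dest: braid_step_word_perm)
  moreover have "w \<in> braid_of n w" by (simp add: braid_of_def)
  ultimately have "(\<lambda>v. word_perm (map index v)) ` braid_of n w = {word_perm (map index w)}"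
    unfolding braid_of_def by blast
  then show ?thesis by (simp add: braid_perm_def)
qed

lemma braid_perm_hom: "braid_perm \<in> hom (braid_group n) (sym_group n)"
proof (rule homI)
  fix X assume "X \<in> carrier (braid_group n)"
  then obtain w where w: "w \<in> braid_words n" "X = braid_of n w" by (auto simp: braid_group_def)
  then have "map index w \<in> perm_words n"
    by (fastforce simp: braid_words_def perm_words_def)
  then show "braid_perm X \<in> carrier (sym_group n)"
    using word_perm_permutes by (simp add: w(2) braid_perm_braid_of sym_group_def)
next
  fix X Y assume "X \<in> carrier (braid_group n)" "Y \<in> carrier (braid_group n)"
  then obtain u v where "X = braid_of n u" "Y = braid_of n v" by (auto simp: braid_group_def)
  then show "braid_perm (X \<otimes>\<^bsub>braid_group n\<^esub> Y) = braid_perm X \<otimes>\<^bsub>sym_group n\<^esub> braid_perm Y"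
    by (simp add: braid_mult braid_perm_braid_of sym_group_def word_perm_append)
qed

end

theory Submission
  imports Defs
begin

text \<open>
  Every even permutation \<open>s\<close> of \<open>{1..n}\<close> is a quotient \<open>\<alpha> \<gamma>\<inverse>\<close> of two \<open>n\<close>-cycles. Indeed, write
  \<open>s\<close> as a product of transpositions \<open>(m a\<^sub>m)\<close> with \<open>a\<^sub>m \<le> m\<close> and build up the cycles from \<open>(1)\<close>. If
  \<open>a\<^sub>m = m\<close>, the point \<open>m\<close> can be inserted into both cycles without changing the quotient. The other
  points are inserted in pairs: putting \<open>u v\<close> before \<open>d\<close> in \<open>\<alpha>\<close> and \<open>v u\<close> before \<open>c\<close> in \<open>\<gamma>\<close>, where
  \<open>s c = e\<close>, multiplies the quotient by \<open>(u d)(v e)\<close>. Since \<open>s\<close> is even, no point is left over.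
  As \<open>\<gamma> = g \<alpha> g\<inverse>\<close> for the permutation \<open>g\<close> that matches the two cycles entry by entry,
  \<open>s = [\<alpha>, g]\<close>. Lifting \<open>\<alpha>\<close> and \<open>g\<close> to permutation braids by sorting gives \<open>d\<^sub>1\<close> and \<open>d\<^sub>2\<close>, and
  \<open>b [d\<^sub>1, d\<^sub>2]\<inverse>\<close> is pure. All steps run in time polynomial in \<open>n\<close> and the length of \<open>b\<close>.
\<close>

section \<open>Polynomial time for encoded functions\<close>

text \<open>One notion of polynomial time thereby covers numbers, words, pairs and nested lists. On
  braid words \<open>enc\<close> agrees with \<open>braid_word_val\<close>.\<close>

class encodable = fixes enc :: "'a \<Rightarrow> val"

instantiation nat :: encodable begin
definition "enc_nat = Atom"
instance ..
end

instantiation bool :: encodable begin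
definition "enc_bool b = Atom (if b then 1 else 0)"
instance ..
end

instantiation letter :: encodable begin
definition "enc_letter = letter_val"
instance ..
end

instantiation prod :: (encodable, encodable) encodable begin
definition "enc_prod z = Pair (enc (fst z)) (enc (snd z))"
instance ..
end

instantiation list :: (encodable) encodable begin
definition "enc_list = list_val enc"
instance ..
end

lemma enc_simps [simp]:
  "enc m = Atom m"
  "enc b = Atom (if b then 1 else 0)"
  "enc (x, y) = Pair (enc x) (enc y)"
  "enc ([] :: 'a::encodable list) = Atom 0"
  "enc (z # zs) = Pair (enc z) (enc zs)"
  "enc (Gen m) = Pair (Atom 0) (Atom m)"
  "enc (GenInv m) = Pair (Atom 1) (Atom m)"
  by (simp_all add: enc_nat_def enc_bool_def enc_prod_def enc_list_def enc_letter_def)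

text \<open>Numbers are measured in unary, because running times are to be polynomial in
  \<open>n\<close> itself. Shared subtrees count once per occurrence.\<close>

fun weight :: "val \<Rightarrow> nat" where
  "weight (Atom m) = Suc m"
| "weight (Pair x y) = Suc (weight x + weight y)"

abbreviation sz :: "'a::encodable \<Rightarrow> nat" where
  "sz x \<equiv> weight (enc x)"

lemma weight_pos [simp]: "0 < weight v"
  by (cases v) auto

section \<open>Functions bounded by a polynomial in the size of the input\<close>

definition poly_bounded :: "('a::encodable \<Rightarrow> nat) \<Rightarrow> bool" where
  "poly_bounded T \<longleftrightarrow> (\<exists>p :: nat poly. \<forall>x. T x \<le> poly p (sz x))"

text \<open>Natural coefficients are never negative. Monotonicity allows a bound on the argument to
  be inserted into a bound on the value.\<close>

lemma poly_nat_mono: "x \<le> y \<Longrightarrow> poly p x \<le> poly p y" for p :: "nat poly"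
  by (induction p) (auto intro: add_mono mult_mono)

named_theorems pb_intros

lemma poly_bounded_le: "poly_bounded U \<Longrightarrow> (\<And>x. T x \<le> U x) \<Longrightarrow> poly_bounded T"
  unfolding poly_bounded_def by (meson le_trans)

lemma poly_bounded_const [pb_intros]: "poly_bounded (\<lambda>x. k)"
  unfolding poly_bounded_def by (rule exI[of _ "[:k:]"]) simp

lemma poly_bounded_sz [pb_intros]: "poly_bounded (\<lambda>x. sz x)"
  unfolding poly_bounded_def by (rule exI[of _ "[:0, 1:]"]) simp

lemma poly_bounded_add [pb_intros]:
  assumes "poly_bounded T" "poly_bounded U" shows "poly_bounded (\<lambda>x. T x + U x)"
proof -
  obtain p q where "\<And>x. T x \<le> poly p (sz x)" "\<And>x. U x \<le> poly q (sz x)"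
    using assms unfolding poly_bounded_def by blast
  then show ?thesis
    unfolding poly_bounded_def by (intro exI[of _ "p + q"]) (simp add: add_mono)
qed

lemma poly_bounded_mult [pb_intros]:
  assumes "poly_bounded T" "poly_bounded U" shows "poly_bounded (\<lambda>x. T x * U x)"
proof -
  obtain p q where "\<And>x. T x \<le> poly p (sz x)" "\<And>x. U x \<le> poly q (sz x)"
    using assms unfolding poly_bounded_def by blast
  then show ?thesis
    unfolding poly_bounded_def by (intro exI[of _ "p * q"]) (simp add: mult_mono)
qed

lemma poly_bounded_poly [pb_intros]:
  assumes "poly_bounded T" shows "poly_bounded (\<lambda>x. poly r (T x))"
proof -
  obtain p where "\<And>x. T x \<le> poly p (sz x)"
    using assms unfolding poly_bounded_def by blast
  then show ?thesis
    unfolding poly_bounded_def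
    by (intro exI[of _ "pcompose r p"]) (simp add: poly_pcompose poly_nat_mono)
qed

lemma poly_bounded_comp:
  assumes "poly_bounded T" "poly_bounded (\<lambda>x. sz (f x))" shows "poly_bounded (\<lambda>x. T (f x))"
proof -
  obtain p where "\<And>x. T x \<le> poly p (sz x)"
    using assms unfolding poly_bounded_def by blast
  then show ?thesis
    using poly_bounded_poly[OF assms(2), of p] by (auto intro: poly_bounded_le)
qed

text \<open>All variables but \<open>''w''\<close> start as \<open>Atom 0\<close>; a program that is
  run inside another one therefore needs its variables reset first.\<close>

definition computes :: "com \<Rightarrow> ('a::encodable \<Rightarrow> 'b::encodable) \<Rightarrow> ('a \<Rightarrow> nat) \<Rightarrow> bool" where
  "computes c f T \<longleftrightarrow> (\<forall>x. \<exists>t s. exec c ((\<lambda>_. Atom 0)(''w'' := enc x)) t s \<and>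
     s ''out'' = enc (f x) \<and> t \<le> T x)"

text \<open>The output size has to be bounded separately: sharing lets a program double the size of a
  value in one step.\<close>

definition polytime :: "('a::encodable \<Rightarrow> 'b::encodable) \<Rightarrow> bool" where
  "polytime f \<longleftrightarrow> poly_bounded (\<lambda>x. sz (f x)) \<and> (\<exists>c T. computes c f T \<and> poly_bounded T)"

lemma polytime_sz: "polytime f \<Longrightarrow> poly_bounded (\<lambda>x. sz (f x))"
  by (simp add: polytime_def)

section \<open>Variables of programs, and programs run as subroutines\<close>

fun expr_vars :: "expr \<Rightarrow> vname set" where
  "expr_vars (Var x) = {x}"
| "expr_vars (Const m) = {}"
| "expr_vars (MkPair a b) = expr_vars a \<union> expr_vars b"
| "expr_vars (Fst a) = expr_vars a"
| "expr_vars (Snd a) = expr_vars a"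
| "expr_vars (Add a b) = expr_vars a \<union> expr_vars b"
| "expr_vars (Sub a b) = expr_vars a \<union> expr_vars b"
| "expr_vars (Less a b) = expr_vars a \<union> expr_vars b"

fun com_vars :: "com \<Rightarrow> vname set" where
  "com_vars Skip = {}"
| "com_vars (Assign x a) = insert x (expr_vars a)"
| "com_vars (Seq c d) = com_vars c \<union> com_vars d"
| "com_vars (If a c d) = expr_vars a \<union> com_vars c \<union> com_vars d"
| "com_vars (While a c) = expr_vars a \<union> com_vars c"

lemma finite_expr_vars: "finite (expr_vars a)"
  by (induction a) auto

lemma finite_com_vars: "finite (com_vars c)"
  by (induction c) (auto simp: finite_expr_vars)

lemma expr_val_cong: "(\<And>x. x \<in> expr_vars a \<Longrightarrow> s x = r x) \<Longrightarrow> expr_val a s = expr_val a r"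
  by (induction a) auto

text \<open>A program neither reads nor writes variables outside \<open>com_vars c\<close>. Hence a
  run can be replayed from any state that agrees with the original one on \<open>V\<close>, and the
  rest of that state survives.\<close>

lemma exec_frame:
  assumes "exec c s t s'" "com_vars c \<subseteq> V" "\<And>x. x \<in> V \<Longrightarrow> r x = s x"
  shows "exec c r t (\<lambda>x. if x \<in> V then s' x else r x)"
  using assms
proof (induction arbitrary: r rule: exec.induct)
  case (Skip s)
  then have "(\<lambda>x. if x \<in> V then s x else r x) = r" by auto
  then show ?case using exec.Skip[of r] by simp
next
  case (Assign x a s)
  then have "expr_val a r = expr_val a s" by (intro expr_val_cong) auto
  with Assign have "(\<lambda>y. if y \<in> V then (s(x := expr_val a s)) y else r y) = r(x := expr_val a r)"
    by auto
  then show ?case using exec.Assign[of x a r] by simp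
next
  case (Seq c1 s t1 s1 c2 t2 s2)
  let ?r1 = "\<lambda>x. if x \<in> V then s1 x else r x"
  have "exec c1 r t1 ?r1" using Seq by auto
  moreover have "exec c2 ?r1 t2 (\<lambda>x. if x \<in> V then s2 x else ?r1 x)"
    using Seq by auto
  moreover have "(\<lambda>x. if x \<in> V then s2 x else ?r1 x) = (\<lambda>x. if x \<in> V then s2 x else r x)" by auto
  ultimately show ?case by (simp add: exec.Seq)
next
  case (IfTrue a s c1 t s' c2)
  then have "expr_val a r = expr_val a s" by (intro expr_val_cong) auto
  with IfTrue show ?case by (intro exec.IfTrue) auto
next
  case (IfFalse a s c2 t s' c1)
  then have "expr_val a r = expr_val a s" by (intro expr_val_cong) auto
  with IfFalse show ?case by (intro exec.IfFalse) auto
next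
  case (WhileFalse a s c)
  then have "expr_val a r = expr_val a s" by (intro expr_val_cong) auto
  moreover have "(\<lambda>x. if x \<in> V then s x else r x) = r" using WhileFalse by auto
  ultimately show ?case using WhileFalse exec.WhileFalse[of a r c] by simp
next
  case (WhileTrue a s c t1 s1 t2 s2)
  let ?r1 = "\<lambda>x. if x \<in> V then s1 x else r x"
  have "exec c r t1 ?r1" using WhileTrue by auto
  moreover have "exec (While a c) ?r1 t2 (\<lambda>x. if x \<in> V then s2 x else ?r1 x)"
    using WhileTrue by auto
  moreover have "(\<lambda>x. if x \<in> V then s2 x else ?r1 x) = (\<lambda>x. if x \<in> V then s2 x else r x)" by auto
  moreover have "expr_val a r = expr_val a s" using WhileTrue by (intro expr_val_cong) auto
  ultimately show ?case using WhileTrue.hyps exec.WhileTrue[of a r c t1 ?r1 t2] by simp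
qed

lemma exec_clear:
  "exec (foldr (\<lambda>x. Seq (Assign x (Const 0))) xs Skip) s (Suc (length xs))
     (\<lambda>x. if x \<in> set xs then Atom 0 else s x)"
proof (induction xs arbitrary: s)
  case Nil
  show ?case by (simp add: exec.Skip[simplified])
next
  case (Cons y xs)
  have "exec (Assign y (Const 0)) s 1 (s(y := Atom 0))"
    using exec.Assign[of y "Const 0" s] by simp
  from exec.Seq[OF this Cons.IH]
  have "exec (foldr (\<lambda>x. Seq (Assign x (Const 0))) (y # xs) Skip) s (1 + Suc (length xs))
     (\<lambda>x. if x \<in> set xs then Atom 0 else (s(y := Atom 0)) x)" by simp
  moreover have "(\<lambda>x. if x \<in> set xs then Atom 0 else (s(y := Atom 0)) x)
      = (\<lambda>x. if x \<in> set (y # xs) then Atom 0 else s x)" by auto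
  ultimately show ?case by simp
qed

lemma exec_Assign: "s' = s(x := expr_val a s) \<Longrightarrow> exec (Assign x a) s 1 s'"
  using exec.Assign[of x a s] by simp

text \<open>Calling convention: the argument is an expression in the caller's variables, and
  everything outside the finite set \<open>V\<close> survives the call. A caller can thus keep
  intermediate values in a variable outside \<open>V\<close>.\<close>

definition subroutine ::
  "('a::encodable \<Rightarrow> 'b::encodable) \<Rightarrow> (expr \<Rightarrow> com) \<Rightarrow> vname set \<Rightarrow> ('a \<Rightarrow> nat) \<Rightarrow> bool" where
  "subroutine f call V T \<longleftrightarrow> finite V \<and> ''w'' \<in> V \<and> ''out'' \<in> V \<and> poly_bounded T \<and>
     (\<forall>e s x. expr_val e s = enc x \<longrightarrow> (\<exists>t s'. exec (call e) s t s' \<and>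
        s' ''out'' = enc (f x) \<and> t \<le> T x \<and> (\<forall>y. y \<notin> V \<longrightarrow> s' y = s y)))"

lemma subroutineE:
  assumes "subroutine f call V T" "expr_val e s = enc x"
  obtains t s' where "exec (call e) s t s'" "s' ''out'' = enc (f x)" "t \<le> T x"
    "\<forall>y. y \<notin> V \<longrightarrow> s' y = s y"
  using assms unfolding subroutine_def by meson

lemma subroutineD:
  "subroutine f call V T \<Longrightarrow> finite V \<and> ''w'' \<in> V \<and> ''out'' \<in> V"
  "subroutine f call V T \<Longrightarrow> poly_bounded T"
  by (simp_all add: subroutine_def)

lemma polytime_subroutine:
  assumes "polytime f" shows "\<exists>call V T. subroutine f call V T"
proof -
  obtain c T where c: "computes c f T" and T: "poly_bounded T"
    using assms unfolding polytime_def by blast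
  define V where "V = com_vars c \<union> {''w'', ''out''}"
  have "finite V" by (simp add: V_def finite_com_vars)
  then obtain xs where xs: "set xs = V - {''w''}" using finite_list[of "V - {''w''}"] by auto
  \<comment> \<open>The argument is evaluated before the variables are cleared, so it may mention
    variables of \<open>V\<close>. The variable \<open>''w''\<close> is exempt from clearing because
    it now holds the argument.\<close>
  define call where "call e = Seq (Assign ''w'' e)
    (Seq (foldr (\<lambda>x. Seq (Assign x (Const 0))) xs Skip) c)" for e
  have "\<exists>t s'. exec (call e) s t s' \<and> s' ''out'' = enc (f x) \<and> t \<le> T x + (length xs + 2) \<and>
      (\<forall>y. y \<notin> V \<longrightarrow> s' y = s y)" if e: "expr_val e s = enc x" for e s x
  proof -
    obtain t s' where s': "exec c ((\<lambda>_. Atom 0)(''w'' := enc x)) t s'" "s' ''out'' = enc (f x)" "t \<le> T x"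
      using c unfolding computes_def by blast
    let ?r1 = "s(''w'' := enc x)"
    let ?r2 = "\<lambda>x. if x \<in> set xs then Atom 0 else ?r1 x"
    have "exec c ?r2 t (\<lambda>x. if x \<in> V then s' x else ?r2 x)"
      by (rule exec_frame[OF s'(1)]) (auto simp: V_def xs)
    moreover have "exec (Assign ''w'' e) s 1 ?r1" using e by (intro exec_Assign) simp
    ultimately have "exec (call e) s (1 + (Suc (length xs) + t)) (\<lambda>x. if x \<in> V then s' x else ?r2 x)"
      unfolding call_def by (intro exec.Seq[OF _ exec.Seq[OF exec_clear[of xs ?r1]]])
    then show ?thesis
      using s' by (intro exI[of _ "1 + (Suc (length xs) + t)"]
        exI[of _ "\<lambda>x. if x \<in> V then s' x else ?r2 x"]) (auto simp: V_def xs)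
  qed
  moreover have "poly_bounded (\<lambda>x. T x + (length xs + 2))" by (intro pb_intros T)
  moreover have "''w'' \<in> V" "''out'' \<in> V" by (auto simp: V_def)
  ultimately show ?thesis using \<open>finite V\<close> unfolding subroutine_def by blast
qed

lemma fresh_vname: "finite V \<Longrightarrow> \<exists>z :: vname. z \<notin> V"
  by (simp add: ex_new_if_finite infinite_UNIV_listI)

lemma polytimeI:
  assumes "poly_bounded (\<lambda>x. sz (f x))" "poly_bounded T"
    and "\<And>x s. s ''w'' = enc x \<Longrightarrow> \<exists>t s'. exec c s t s' \<and> s' ''out'' = enc (f x) \<and> t \<le> T x"
  shows "polytime f"
proof -
  have "computes c f T" unfolding computes_def using assms(3) by simp
  then show ?thesis unfolding polytime_def using assms by blast
qed

section \<open>Closure of polynomial time under basic constructions\<close>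

named_theorems pt_intros

lemma weight_fst_of: "weight (fst_of v) \<le> weight v"
  by (cases v) auto

lemma weight_snd_of: "weight (snd_of v) \<le> weight v"
  by (cases v) auto

lemma atom_of_le_weight: "atom_of v \<le> weight v"
  by (cases v) auto

text \<open>Projections do not enlarge a value, and every binary operator yields at most the sum of
  both sizes plus one. So a fixed expression allows only polynomial growth.\<close>

lemma expr_weight:
  "\<exists>p. \<forall>s m. (\<forall>x. weight (s x) \<le> m) \<longrightarrow> weight (expr_val a s) \<le> poly p m"
proof -
  let ?B = "\<lambda>a p. \<forall>s m. (\<forall>x. weight (s x) \<le> m) \<longrightarrow> weight (expr_val a s) \<le> poly p m"
  have two: "\<exists>p. ?B c p" if IH: "\<exists>p. ?B a p" "\<exists>p. ?B b p"
    and le: "\<And>s. weight (expr_val c s) \<le> 1 + weight (expr_val a s) + weight (expr_val b s)" for a b c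
  proof -
    from IH obtain p q where "?B a p" "?B b q" by blast
    have "weight (expr_val c s) \<le> poly (1 + p + q) m" if "\<forall>x. weight (s x) \<le> m" for s m
    proof -
      have "weight (expr_val a s) \<le> poly p m" "weight (expr_val b s) \<le> poly q m"
        using \<open>?B a p\<close> \<open>?B b q\<close> that by blast+
      then show ?thesis using le[of s] by simp
    qed
    then show ?thesis by blast
  qed
  show ?thesis
  proof (induction a)
    case (Var x)
    then show ?case by (intro exI[of _ "[:0, 1:]"]) simp
  next
    case (Const k)
    then show ?case by (intro exI[of _ "[:Suc k:]"]) simp
  next
    case (MkPair a b)
    then show ?case by (rule two) simp
  next
    case (Fst a)
    then show ?case by (metis expr_val.simps(4) weight_fst_of le_trans)
  next
    case (Snd a)
    then show ?case by (metis expr_val.simps(5) weight_snd_of le_trans)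
  next
    case (Add a b)
    then show ?case
      by (rule two) (simp add: add_mono atom_of_le_weight)
  next
    case (Sub a b)
    then show ?case
      by (rule two) (use atom_of_le_weight in \<open>simp add: le_diff_conv trans_le_add1\<close>)
  next
    case (Less a b)
    then show ?case by (rule two) (simp add: Suc_le_eq)
  qed
qed

lemma polytime_expr:
  assumes "\<And>x s. s ''w'' = enc x \<Longrightarrow> expr_val a s = enc (f x)"
  shows "polytime f"
proof (rule polytimeI)
  obtain p where p: "\<And>s m. (\<forall>x. weight (s x) \<le> m) \<Longrightarrow> weight (expr_val a s) \<le> poly p m"
    using expr_weight by meson
  \<comment> \<open>The value depends on \<open>''w''\<close> only, so the bound may be read off in
    the state that holds \<open>enc x\<close> in every variable.\<close>
  have "sz (f x) \<le> poly p (sz x)" for x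
    using p[of "\<lambda>_. enc x" "sz x"] assms[of "\<lambda>_. enc x" x] by simp
  then show "poly_bounded (\<lambda>x. sz (f x))" unfolding poly_bounded_def by blast
  show "\<exists>t s'. exec (Assign ''out'' a) s t s' \<and> s' ''out'' = enc (f x) \<and> t \<le> 1"
    if "s ''w'' = enc x" for s x
    using exec_Assign[OF refl, of "''out''" a s] assms[of s x] that by (metis fun_upd_same order_refl)
qed (intro pb_intros)

lemma polytime_id [pt_intros]: "polytime (\<lambda>x. x)"
  by (rule polytime_expr[of "Var ''w''"]) simp

lemma polytime_const [pt_intros]: "polytime (\<lambda>x. k)"
proof -
  have "\<exists>a. \<forall>s. expr_val a s = v" for v
  proof (induction v)
    case (Atom m)
    then show ?case by (intro exI[of _ "Const m"]) simp
  next
    case (Pair u v)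
    then obtain a b where "\<forall>s. expr_val a s = u" "\<forall>s. expr_val b s = v" by blast
    then show ?case by (intro exI[of _ "MkPair a b"]) simp
  qed
  then show ?thesis using polytime_expr by metis
qed

lemma exec_resultI:
  "exec c s t s' \<Longrightarrow> s' ''out'' = v \<Longrightarrow> t \<le> T \<Longrightarrow> \<exists>t s'. exec c s t s' \<and> s' ''out'' = v \<and> t \<le> T"
  by blast

lemma polytime_comp:
  fixes f :: "'a::encodable \<Rightarrow> 'b::encodable" and g :: "'b \<Rightarrow> 'c::encodable"
  assumes "polytime g" "polytime f" shows "polytime (\<lambda>x. g (f x))"
proof -
  obtain cf Vf Tf where f: "subroutine f cf Vf Tf"
    using polytime_subroutine[OF assms(2)] by blast
  obtain cg Vg Tg where g: "subroutine g cg Vg Tg"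
    using polytime_subroutine[OF assms(1)] by blast
  have sf: "poly_bounded (\<lambda>x. sz (f x))" by (rule polytime_sz) fact
  show ?thesis
  proof (rule polytimeI)
    show "poly_bounded (\<lambda>x. sz (g (f x)))"
      by (rule poly_bounded_comp[OF polytime_sz sf]) fact
    show "poly_bounded (\<lambda>x. Tf x + Tg (f x))"
      by (intro pb_intros subroutineD(2)[OF f] poly_bounded_comp[OF subroutineD(2)[OF g] sf])
    fix x :: 'a and s assume "s ''w'' = enc x"
    then have "expr_val (Var ''w'') s = enc x" by simp
    from subroutineE[OF f this] obtain t s1 where 1: "exec (cf (Var ''w'')) s t s1"
      "s1 ''out'' = enc (f x)" "t \<le> Tf x" .
    then have "expr_val (Var ''out'') s1 = enc (f x)" by simp
    from subroutineE[OF g this] obtain u s2 where 2: "exec (cg (Var ''out'')) s1 u s2"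
      "s2 ''out'' = enc (g (f x))" "u \<le> Tg (f x)" .
    show "\<exists>t s'. exec (Seq (cf (Var ''w'')) (cg (Var ''out''))) s t s' \<and> s' ''out'' = enc (g (f x)) \<and>
        t \<le> Tf x + Tg (f x)"
      by (rule exec_resultI[OF exec.Seq[OF 1(1) 2(1)] 2(2) add_mono[OF 1(3) 2(3)]])
  qed
qed

lemma polytime_Pair [pt_intros]:
  fixes f :: "'a::encodable \<Rightarrow> 'b::encodable" and g :: "'a \<Rightarrow> 'c::encodable"
  assumes "polytime f" "polytime g" shows "polytime (\<lambda>x. (f x, g x))"
proof -
  obtain cf Vf Tf where f: "subroutine f cf Vf Tf"
    using polytime_subroutine[OF assms(1)] by blast
  obtain cg Vg Tg where g: "subroutine g cg Vg Tg"
    using polytime_subroutine[OF assms(2)] by blast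
  have fin: "finite (Vf \<union> Vg)" using subroutineD(1)[OF f] subroutineD(1)[OF g] by simp
  obtain z where z: "z \<notin> Vf \<union> Vg" using fresh_vname[OF fin] by blast
  obtain y where y: "y \<notin> insert z (Vf \<union> Vg)"
    using fresh_vname[of "insert z (Vf \<union> Vg)"] fin by blast
  \<comment> \<open>\<open>z\<close> keeps the input during both calls and \<open>y\<close> keeps
    the first result during the second one.\<close>
  let ?c = "Seq (Assign z (Var ''w'')) (Seq (cf (Var z)) (Seq (Assign y (Var ''out''))
     (Seq (cg (Var z)) (Assign ''out'' (MkPair (Var y) (Var ''out''))))))"
  show ?thesis
  proof (rule polytimeI)
    show "poly_bounded (\<lambda>x. sz (f x, g x))"
      by (rule poly_bounded_le[of "\<lambda>x. sz (f x) + (sz (g x) + 1)"])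
        (intro pb_intros polytime_sz assms, simp)
    show "poly_bounded (\<lambda>x. Tf x + (Tg x + 3))" by (intro pb_intros subroutineD(2)[OF f] subroutineD(2)[OF g])
    fix x :: 'a and s assume w: "s ''w'' = enc x"
    let ?s0 = "s(z := enc x)"
    have "expr_val (Var z) ?s0 = enc x" by simp
    from subroutineE[OF f this] obtain t s1 where 1: "exec (cf (Var z)) ?s0 t s1"
      "s1 ''out'' = enc (f x)" "t \<le> Tf x" "\<forall>v. v \<notin> Vf \<longrightarrow> s1 v = ?s0 v" .
    let ?s2 = "s1(y := enc (f x))"
    have "expr_val (Var z) ?s2 = enc x" using 1(4) z y by auto
    from subroutineE[OF g this] obtain u s3 where 2: "exec (cg (Var z)) ?s2 u s3"
      "s3 ''out'' = enc (g x)" "u \<le> Tg x" "\<forall>v. v \<notin> Vg \<longrightarrow> s3 v = ?s2 v" .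
    have s3: "s3 y = enc (f x)" using 2(4) y by simp
    have a: "exec (Assign z (Var ''w'')) s 1 ?s0" by (rule exec_Assign) (simp add: w)
    have b: "exec (Assign y (Var ''out'')) s1 1 ?s2" by (rule exec_Assign) (simp add: 1(2))
    have c: "exec (Assign ''out'' (MkPair (Var y) (Var ''out''))) s3 1 (s3(''out'' := enc (f x, g x)))"
      by (rule exec_Assign) (simp add: 2(2) s3)
    have "exec ?c s (1 + (t + (1 + (u + 1)))) (s3(''out'' := enc (f x, g x)))"
      by (rule exec.Seq[OF a exec.Seq[OF 1(1) exec.Seq[OF b exec.Seq[OF 2(1) c]]]])
    then show "\<exists>t s'. exec ?c s t s' \<and> s' ''out'' = enc (f x, g x) \<and> t \<le> Tf x + (Tg x + 3)"
      by (rule exec_resultI) (use 1(3) 2(3) in simp_all)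
  qed
qed

lemma polytime_If [pt_intros]:
  fixes f g :: "'a::encodable \<Rightarrow> 'b::encodable"
  assumes "polytime b" "polytime f" "polytime g"
  shows "polytime (\<lambda>x. if b x then f x else g x)"
proof -
  obtain cb Vb Tb where b: "subroutine b cb Vb Tb"
    using polytime_subroutine[OF assms(1)] by blast
  obtain cf Vf Tf where f: "subroutine f cf Vf Tf"
    using polytime_subroutine[OF assms(2)] by blast
  obtain cg Vg Tg where g: "subroutine g cg Vg Tg"
    using polytime_subroutine[OF assms(3)] by blast
  \<comment> \<open>Only the call of \<open>b\<close> has to preserve \<open>z\<close>: a branch
    reads \<open>z\<close> just once, as its argument.\<close>
  obtain z where z: "z \<notin> Vb" using fresh_vname[of Vb] subroutineD(1)[OF b] by blast
  let ?c = "Seq (Assign z (Var ''w'')) (Seq (cb (Var z)) (If (Var ''out'') (cf (Var z)) (cg (Var z))))"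
  show ?thesis
  proof (rule polytimeI)
    show "poly_bounded (\<lambda>x. sz (if b x then f x else g x))"
      by (rule poly_bounded_le[of "\<lambda>x. sz (f x) + sz (g x)"])
        (intro pb_intros polytime_sz assms, simp)
    show "poly_bounded (\<lambda>x. Tb x + (Tf x + (Tg x + 2)))" by (intro pb_intros b[THEN subroutineD(2)] f[THEN subroutineD(2)] g[THEN subroutineD(2)])
    fix x :: 'a and s assume w: "s ''w'' = enc x"
    let ?s0 = "s(z := enc x)"
    have "expr_val (Var z) ?s0 = enc x" by simp
    from subroutineE[OF b this] obtain t s1 where 1: "exec (cb (Var z)) ?s0 t s1"
      "s1 ''out'' = enc (b x)" "t \<le> Tb x" "\<forall>v. v \<notin> Vb \<longrightarrow> s1 v = ?s0 v" .
    have s1: "expr_val (Var z) s1 = enc x" using 1(4) z by simp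
    obtain u s2 where 2: "exec (If (Var ''out'') (cf (Var z)) (cg (Var z))) s1 (u + 1) s2"
        "s2 ''out'' = enc (if b x then f x else g x)" "u \<le> Tf x + Tg x"
    proof (cases "b x")
      case True
      from subroutineE[OF f s1] obtain u s2 where 2: "exec (cf (Var z)) s1 u s2"
        "s2 ''out'' = enc (f x)" "u \<le> Tf x" .
      show ?thesis by (rule that[OF exec.IfTrue[OF _ 2(1)]]) (use 1(2) 2 True in simp_all)
    next
      case False
      from subroutineE[OF g s1] obtain u s2 where 2: "exec (cg (Var z)) s1 u s2"
        "s2 ''out'' = enc (g x)" "u \<le> Tg x" .
      show ?thesis by (rule that[OF exec.IfFalse[OF _ 2(1)]]) (use 1(2) 2 False in simp_all)
    qed
    have "exec ?c s (1 + (t + (u + 1))) s2"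
      by (rule exec.Seq[OF exec_Assign exec.Seq[OF 1(1) 2(1)]]) (simp add: w)
    then show "\<exists>t s'. exec ?c s t s' \<and> s' ''out'' = enc (if b x then f x else g x) \<and>
        t \<le> Tb x + (Tf x + (Tg x + 2))"
      by (rule exec_resultI) (use 1(3) 2(2,3) in simp_all)
  qed
qed

text \<open>The empty list is \<open>Atom 0\<close> and every other list is a pair, so the list
  itself serves as the condition. The component \<open>e\<close> carries the data on which the
  branches may depend besides the list.\<close>

lemma polytime_case_list_aux:
  fixes f :: "'a::encodable \<Rightarrow> 'b::encodable" and g :: "'c::encodable \<times> 'c list \<times> 'a \<Rightarrow> 'b"
  assumes "polytime f" "polytime g"
  shows "polytime (\<lambda>(l, e). case l of [] \<Rightarrow> f e | y # ys \<Rightarrow> g (y, ys, e))" (is "polytime ?h")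
proof -
  obtain cf Vf Tf where f: "subroutine f cf Vf Tf"
    using polytime_subroutine[OF assms(1)] by blast
  obtain cg Vg Tg where g: "subroutine g cg Vg Tg"
    using polytime_subroutine[OF assms(2)] by blast
  let ?a = "MkPair (Fst (Fst (Var ''w''))) (MkPair (Snd (Fst (Var ''w''))) (Snd (Var ''w'')))"
  let ?c = "If (Fst (Var ''w'')) (cg ?a) (cf (Snd (Var ''w'')))"
  obtain pf qf where pf: "\<And>x. sz (f x) \<le> poly pf (sz x)" "\<And>x. Tf x \<le> poly qf (sz x)"
    using polytime_sz[OF assms(1)] subroutineD(2)[OF f] unfolding poly_bounded_def by blast
  obtain pg qg where pg: "\<And>x. sz (g x) \<le> poly pg (sz x)" "\<And>x. Tg x \<le> poly qg (sz x)"
    using polytime_sz[OF assms(2)] subroutineD(2)[OF g] unfolding poly_bounded_def by blast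
  show ?thesis
  proof (rule polytimeI)
    let ?U = "\<lambda>x. poly pf (sz x) + poly pg (sz x)"
    have "sz (?h x) \<le> ?U x" for x
    proof (cases x)
      case (Pair l e)
      then show ?thesis
      proof (cases l)
        case Nil
        have "sz (f e) \<le> poly pf (sz x)" using Pair by (intro le_trans[OF pf(1)] poly_nat_mono) simp
        then show ?thesis using Nil Pair by (simp add: trans_le_add1)
      next
        case (Cons y ys)
        have "sz (g (y, ys, e)) \<le> poly pg (sz x)"
          using Pair Cons by (intro le_trans[OF pg(1)] poly_nat_mono) simp
        then show ?thesis using Cons Pair by (simp add: trans_le_add2)
      qed
    qed
    then show "poly_bounded (\<lambda>x. sz (?h x))"
      by (rule poly_bounded_le[rotated]) (intro pb_intros)
    show "poly_bounded (\<lambda>x. 1 + (poly qf (sz x) + poly qg (sz x)))" by (intro pb_intros)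
    fix x :: "'c list \<times> 'a" and s assume w: "s ''w'' = enc x"
    obtain l e where x: "x = (l, e)" by (cases x)
    show "\<exists>t s'. exec ?c s t s' \<and> s' ''out'' = enc (?h x) \<and> t \<le> 1 + (poly qf (sz x) + poly qg (sz x))"
    proof (cases l)
      case Nil
      then have "expr_val (Snd (Var ''w'')) s = enc e" using w x by simp
      from subroutineE[OF f this] obtain t s' where 1: "exec (cf (Snd (Var ''w''))) s t s'"
        "s' ''out'' = enc (f e)" "t \<le> Tf e" .
      have "exec ?c s (t + 1) s'" using 1(1) w x Nil by (intro exec.IfFalse) auto
      moreover have "Tf e \<le> poly qf (sz x)" using x by (intro le_trans[OF pf(2)] poly_nat_mono) simp
      ultimately show ?thesis using 1 x Nil by (intro exI[of _ "t + 1"] exI[of _ s']) auto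
    next
      case (Cons y ys)
      then have "expr_val ?a s = enc (y, ys, e)" using w x by simp
      from subroutineE[OF g this] obtain t s' where 1: "exec (cg ?a) s t s'"
        "s' ''out'' = enc (g (y, ys, e))" "t \<le> Tg (y, ys, e)" .
      have "exec ?c s (t + 1) s'" using 1(1) w x Cons by (intro exec.IfTrue) auto
      moreover have "Tg (y, ys, e) \<le> poly qg (sz x)"
        using x Cons by (intro le_trans[OF pg(2)] poly_nat_mono) simp
      ultimately show ?thesis using 1 x Cons by (intro exI[of _ "t + 1"] exI[of _ s']) auto
    qed
  qed
qed

text \<open>The first component of the state is the loop condition. The bound \<open>M\<close> on
  all intermediate sizes is assumed because iterating a polynomial-time step can produce
  exponentially large values.\<close>

lemma polytime_while:
  fixes step :: "'c::encodable \<times> 'd::encodable \<Rightarrow> 'c \<times> 'd" and N M :: "'c \<times> 'd \<Rightarrow> nat"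
  assumes "polytime step" "poly_bounded N" "poly_bounded M"
    and size: "\<And>x i. i \<le> N x \<Longrightarrow> sz ((step ^^ i) x) \<le> M x"
    and go: "\<And>x i. i < N x \<Longrightarrow> enc (fst ((step ^^ i) x)) \<noteq> Atom 0"
    and stop: "\<And>x. enc (fst ((step ^^ N x) x)) = Atom 0"
  shows "polytime (\<lambda>x. (step ^^ N x) x)"
proof -
  obtain cf V T where f: "subroutine step cf V T"
    using polytime_subroutine[OF assms(1)] by blast
  obtain p where p: "\<And>x. T x \<le> poly p (sz x)" using subroutineD(2)[OF f] unfolding poly_bounded_def by blast
  obtain z where z: "z \<notin> V" using fresh_vname[of V] subroutineD(1)[OF f] by blast
  let ?B = "Seq (cf (Var z)) (Assign z (Var ''out''))"
  let ?W = "While (Fst (Var z)) ?B"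
  let ?c = "Seq (Assign z (Var ''w'')) (Seq ?W (Assign ''out'' (Var z)))"
  have fst_enc: "fst_of (enc y) = enc (fst y)" for y :: "'c \<times> 'd" by (cases y) simp
  have loop: "\<exists>t s'. exec ?W s t s' \<and> s' z = enc ((step ^^ N x) x) \<and>
      t \<le> (N x - i) * (poly p (M x) + 2) + 1"
    if "i \<le> N x" "s z = enc ((step ^^ i) x)" for s x i
    using that
  proof (induction i arbitrary: s rule: inc_induct)
    case base
    then have "exec ?W s 1 s" using stop[of x] by (intro exec.WhileFalse) (simp add: fst_enc)
    then show ?case using base by (intro exI[of _ 1] exI[of _ s]) simp
  next
    case (step i)
    have "expr_val (Var z) s = enc ((step ^^ i) x)" using step.prems by simp
    from subroutineE[OF f this] obtain t s1 where "exec (cf (Var z)) s t s1"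
      "s1 ''out'' = enc (step ((step ^^ i) x))" "t \<le> T ((step ^^ i) x)" .
    then have 1: "exec (cf (Var z)) s t s1" "s1 ''out'' = enc ((step ^^ Suc i) x)"
      "t \<le> T ((step ^^ i) x)" by simp_all
    let ?s2 = "s1(z := enc ((step ^^ Suc i) x))"
    have "exec (Assign z (Var ''out'')) s1 1 ?s2" by (rule exec_Assign) (simp only: expr_val.simps 1(2))
    then have B: "exec ?B s (t + 1) ?s2" by (rule exec.Seq[OF 1(1)])
    have "?s2 z = enc ((step ^^ Suc i) x)" by simp
    from step.IH[of ?s2, OF this] obtain u s3 where 2: "exec ?W ?s2 u s3" "s3 z = enc ((step ^^ N x) x)"
      "u \<le> (N x - Suc i) * (poly p (M x) + 2) + 1" by blast
    have "exec ?W s (t + 1 + u + 1) s3"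
      using step.prems go[OF step.hyps(2)] by (intro exec.WhileTrue[OF _ B 2(1)]) (simp add: fst_enc)
    moreover have "t \<le> poly p (M x)"
      using step.hyps by (intro le_trans[OF 1(3)] le_trans[OF p] poly_nat_mono size) simp
    moreover have "N x - i = Suc (N x - Suc i)" using step.hyps by simp
    ultimately show ?case using 2 by (intro exI[of _ "t + 1 + u + 1"] exI[of _ s3]) auto
  qed
  show ?thesis
  proof (rule polytimeI)
    show "poly_bounded (\<lambda>x. sz ((step ^^ N x) x))"
      by (rule poly_bounded_le[OF assms(3)]) (rule size, simp)
    show "poly_bounded (\<lambda>x. N x * (poly p (M x) + 2) + 3)" by (intro pb_intros assms)
    fix x :: "'c \<times> 'd" and s assume w: "s ''w'' = enc x"
    let ?s0 = "s(z := enc x)"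
    obtain t s1 where 1: "exec ?W ?s0 t s1" "s1 z = enc ((step ^^ N x) x)"
      "t \<le> N x * (poly p (M x) + 2) + 1"
      using loop[of 0 x ?s0] by auto
    have "exec ?c s (1 + (t + 1)) (s1(''out'' := enc ((step ^^ N x) x)))"
      by (rule exec.Seq[OF exec_Assign exec.Seq[OF 1(1) exec_Assign]]) (simp_all add: w 1(2))
    then show "\<exists>t s'. exec ?c s t s' \<and> s' ''out'' = enc ((step ^^ N x) x) \<and>
        t \<le> N x * (poly p (M x) + 2) + 3"
      by (rule exec_resultI) (use 1(3) in simp_all)
  qed
qed

lemma polytime_fst [pt_intros]: "polytime f \<Longrightarrow> polytime (\<lambda>x. fst (f x))"
  by (rule polytime_comp[where g = fst], rule polytime_expr[of "Fst (Var ''w'')"])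
    (auto simp: enc_prod_def)

lemma polytime_snd [pt_intros]: "polytime f \<Longrightarrow> polytime (\<lambda>x. snd (f x))"
  by (rule polytime_comp[where g = snd], rule polytime_expr[of "Snd (Var ''w'')"])
    (auto simp: enc_prod_def)

lemma polytime_comp2:
  assumes "polytime (\<lambda>z. h (fst z) (snd z))" "polytime f" "polytime g"
  shows "polytime (\<lambda>x. h (f x) (g x))"
  using polytime_comp[OF assms(1) polytime_Pair[OF assms(2,3)]] by simp

lemma polytime_add [pt_intros]:
  fixes f g :: "'a::encodable \<Rightarrow> nat"
  shows "polytime f \<Longrightarrow> polytime g \<Longrightarrow> polytime (\<lambda>x. f x + g x)"
  by (rule polytime_comp2[where h = "(+)"],
      rule polytime_expr[of "Add (Fst (Var ''w'')) (Snd (Var ''w''))"])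
    (auto simp: enc_prod_def)

lemma polytime_diff [pt_intros]:
  fixes f g :: "'a::encodable \<Rightarrow> nat"
  shows "polytime f \<Longrightarrow> polytime g \<Longrightarrow> polytime (\<lambda>x. f x - g x)"
  by (rule polytime_comp2[where h = "(-)"],
      rule polytime_expr[of "Sub (Fst (Var ''w'')) (Snd (Var ''w''))"])
    (auto simp: enc_prod_def)

lemma polytime_Suc [pt_intros]: "polytime f \<Longrightarrow> polytime (\<lambda>x. Suc (f x))"
  using polytime_add[OF _ polytime_const[of 1]] by simp

text \<open>The only comparison of the machine is \<open>Less\<close>: two numbers are equal iff
  neither is below the other, that is, iff the two truth values add up to less than 1.\<close>

lemma polytime_eq [pt_intros]:
  fixes f g :: "'a::encodable \<Rightarrow> nat"
  shows "polytime f \<Longrightarrow> polytime g \<Longrightarrow> polytime (\<lambda>x. f x = g x)"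
  by (rule polytime_comp2[where h = "(=)"],
      rule polytime_expr[of "Less (Add (Less (Fst (Var ''w'')) (Snd (Var ''w'')))
         (Less (Snd (Var ''w'')) (Fst (Var ''w'')))) (Const 1)"])
    (auto simp: enc_prod_def)

lemma polytime_min [pt_intros]:
  fixes f g :: "'a::encodable \<Rightarrow> nat"
  assumes "polytime f" "polytime g" shows "polytime (\<lambda>x. min (f x) (g x))"
proof -
  have "min a b = a - (a - b)" for a b :: nat by simp
  then show ?thesis by (simp only:) (intro pt_intros assms)
qed

lemma polytime_Cons [pt_intros]:
  "polytime f \<Longrightarrow> polytime g \<Longrightarrow> polytime (\<lambda>x. f x # g x)"
  by (rule polytime_comp2[where h = "(#)"], rule polytime_expr[of "Var ''w''"])
    (auto simp: enc_prod_def)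

lemma polytime_Gen [pt_intros]: "polytime f \<Longrightarrow> polytime (\<lambda>x. Gen (f x))"
  by (rule polytime_comp[where g = Gen], rule polytime_expr[of "MkPair (Const 0) (Var ''w'')"]) auto

lemma polytime_GenInv [pt_intros]: "polytime f \<Longrightarrow> polytime (\<lambda>x. GenInv (f x))"
  by (rule polytime_comp[where g = GenInv], rule polytime_expr[of "MkPair (Const 1) (Var ''w'')"]) auto

lemma polytime_index [pt_intros]:
  assumes "polytime f" shows "polytime (\<lambda>x. index (f x))"
proof -
  have "snd_of (enc l) = Atom (index l)" for l by (cases l) auto
  then have "polytime index" by (intro polytime_expr[of "Snd (Var ''w'')"]) simp
  then show ?thesis by (rule polytime_comp) (rule assms)
qed

lemma polytime_case_list:
  assumes "polytime l" "polytime a" "polytime (\<lambda>z. b (fst z) (fst (snd z)) (snd (snd z)))"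
  shows "polytime (\<lambda>x. case l x of [] \<Rightarrow> a x | y # ys \<Rightarrow> b y ys x)"
proof -
  have "polytime (\<lambda>x. (l x, x))" by (intro pt_intros assms)
  from polytime_comp[OF polytime_case_list_aux[OF assms(2,3)] this] show ?thesis
    unfolding prod.case fst_conv snd_conv .
qed

section \<open>Sizes of lists and iteration over lists\<close>

lemma sz_append: "sz (xs @ ys) + 1 = sz xs + sz ys" for xs ys :: "'a::encodable list"
  by (induction xs) auto

lemma length_le_sz: "length xs \<le> sz xs" for xs :: "'a::encodable list"
  by (induction xs) auto

lemma elem_sz: "y \<in> set ys \<Longrightarrow> sz y \<le> sz ys" for ys :: "'a::encodable list"
  by (induction ys) auto

lemma sz_list_le:
  fixes xs :: "'a::encodable list"
  shows "(\<And>x. x \<in> set xs \<Longrightarrow> sz x \<le> m) \<Longrightarrow> sz xs \<le> length xs * Suc m + 1"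
proof (induction xs)
  case (Cons y ys)
  then have "sz y \<le> m" "sz ys \<le> length ys * Suc m + 1" by simp_all
  then show ?case by simp
qed simp

lemma sz_drop_le: "sz (drop i ys) \<le> sz ys" for ys :: "'a::encodable list"
  by (induction ys arbitrary: i) (auto simp: drop_Cons le_SucI trans_le_add2 split: nat.split)

text \<open>The potential \<open>\<phi>\<close> accounts for accumulators that are moved around inside themselves, so that
  their encoding does not grow by a bounded amount in each single step.\<close>

lemma polytime_foldl_aux:
  fixes f :: "'e::encodable \<Rightarrow> 'b::encodable \<Rightarrow> 'y::encodable \<Rightarrow> 'b"
  assumes f: "polytime (\<lambda>z. f (fst z) (fst (snd z)) (snd (snd z)))"
    and \<phi>: "\<And>acc. sz acc \<le> \<phi> acc" "poly_bounded \<phi>"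
    and grow: "\<And>e acc y. \<phi> (f e acc y) \<le> \<phi> acc + poly q (sz e + sz y)"
  shows "polytime (\<lambda>(l, a, e). foldl (f e) a l)"
proof -
  \<comment> \<open>The loop state consists of the unread list, which is also the loop condition,
    the accumulator and the environment.\<close>
  define step where "step z = (case z of (l, a, e) \<Rightarrow>
    case l of [] \<Rightarrow> (l, a, e) | y # ys \<Rightarrow> (ys, f e a y, e))" for z :: "'y list \<times> 'b \<times> 'e"
  have "polytime (\<lambda>z. f (snd (snd (snd (snd z)))) (fst (snd (snd (snd z)))) (fst z))"
    for z :: "'y \<times> 'y list \<times> 'y list \<times> 'b \<times> 'e"
    using polytime_comp[OF f, of "\<lambda>z. (snd (snd (snd (snd z))), fst (snd (snd (snd z))), fst z)"]
    by (simp add: pt_intros)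
  then have step: "polytime step"
    unfolding step_def case_prod_beta by (intro polytime_case_list pt_intros)
  have iter: "i \<le> length l \<Longrightarrow> (step ^^ i) (l, a, e) = (drop i l, foldl (f e) a (take i l), e)" for i l a e
  proof (induction i)
    case (Suc i)
    then have "drop i l = l ! i # drop (Suc i) l" "take (Suc i) l = take i l @ [l ! i]"
      by (simp_all add: Cons_nth_drop_Suc take_Suc_conv_app_nth)
    with Suc show ?case by (simp add: step_def)
  qed simp
  let ?N = "\<lambda>z :: 'y list \<times> 'b \<times> 'e. length (fst z)"
  \<comment> \<open>The accumulator starts with its potential and gains at most
    \<open>poly q (sz z)\<close> in each of at most \<open>sz z\<close> rounds; the other summands
    cover the unread list, the environment and the pairing.\<close>
  let ?M = "\<lambda>z :: 'y list \<times> 'b \<times> 'e. 2 * sz z + 2 + (\<phi> (fst (snd z)) + sz z * poly q (sz z))"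
  have growth: "\<phi> (foldl (f e) a xs) \<le> \<phi> a + length xs * poly q m"
    if "\<forall>y\<in>set xs. sz e + sz y \<le> m" for e a xs m
    using that
  proof (induction xs arbitrary: a)
    case (Cons y ys)
    have "\<phi> (foldl (f e) (f e a y) ys) \<le> \<phi> (f e a y) + length ys * poly q m"
      using Cons by simp
    moreover have "\<phi> (f e a y) \<le> \<phi> a + poly q m"
      by (rule le_trans[OF grow]) (use Cons.prems in \<open>simp add: poly_nat_mono\<close>)
    ultimately show ?case by simp
  qed simp
  have "polytime (\<lambda>z. (step ^^ ?N z) z)"
  proof (rule polytime_while[OF step, of ?N ?M])
    show "poly_bounded ?N"
      by (rule poly_bounded_le[OF poly_bounded_sz]) (auto simp: enc_prod_def intro: length_le_sz le_SucI trans_le_add1)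
    have "poly_bounded (\<lambda>z :: 'y list \<times> 'b \<times> 'e. \<phi> (fst (snd z)))"
      by (rule poly_bounded_comp[OF \<phi>(2)], rule polytime_sz) (intro pt_intros)
    then show "poly_bounded ?M" by (intro pb_intros)
    fix z :: "'y list \<times> 'b \<times> 'e" and i
    obtain l a e where z: "z = (l, a, e)" by (cases z)
    show "sz ((step ^^ i) z) \<le> ?M z" if "i \<le> ?N z"
    proof -
      have "\<phi> (foldl (f e) a (take i l)) \<le> \<phi> a + length (take i l) * poly q (sz z)"
      proof (intro growth ballI)
        fix y assume "y \<in> set (take i l)"
        then have "sz y \<le> sz l" by (intro elem_sz) (rule in_set_takeD)
        then show "sz e + sz y \<le> sz z" using z by simp
      qed
      also have "length (take i l) * poly q (sz z) \<le> sz z * poly q (sz z)"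
        using z length_le_sz[of l] by (intro mult_right_mono) auto
      finally show ?thesis
        using that z \<phi>(1)[of "foldl (f e) a (take i l)"] sz_drop_le[of i l] by (simp add: iter)
    qed
    show "enc (fst ((step ^^ i) z)) \<noteq> Atom 0" if "i < ?N z"
      using that z by (cases "drop i l") (auto simp: iter)
    show "enc (fst ((step ^^ ?N z) z)) = Atom 0" using z by (simp add: iter)
  qed
  from polytime_fst[OF polytime_snd[OF this]] show ?thesis
    by (simp add: case_prod_beta' iter[of "length (fst z)" "fst z" "fst (snd z)" "snd (snd z)" for z, simplified])
qed

lemma polytime_foldl_potential:
  assumes f: "polytime (\<lambda>z. f (fst z) (fst (snd z)) (snd (snd z)))"
    and "\<And>acc. sz acc \<le> \<phi> acc" "poly_bounded \<phi>"
    and "\<And>e acc y. \<phi> (f e acc y) \<le> \<phi> acc + poly q (sz e + sz y)"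
    and "polytime l" "polytime a"
  shows "polytime (\<lambda>x. foldl (f x) (a x) (l x))"
proof -
  have "polytime (\<lambda>x. (l x, a x, x))" by (intro pt_intros assms)
  from polytime_comp[OF polytime_foldl_aux[OF assms(1-4)] this] show ?thesis by simp
qed

lemma polytime_foldl:
  assumes "polytime (\<lambda>z. f (fst z) (fst (snd z)) (snd (snd z)))"
    and "\<And>e acc y. sz (f e acc y) \<le> sz acc + poly q (sz e + sz y)"
    and "polytime l" "polytime a"
  shows "polytime (\<lambda>x. foldl (f x) (a x) (l x))"
  by (rule polytime_foldl_potential[where \<phi> = sz and q = q]) (use assms in \<open>auto intro: pb_intros\<close>)

lemma polytime_rev [pt_intros]:
  fixes l :: "'a::encodable \<Rightarrow> 'b::encodable list"
  assumes "polytime l" shows "polytime (\<lambda>x. rev (l x))"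
proof -
  have "polytime (\<lambda>x. foldl (\<lambda>acc y. y # acc) [] (l x))"
    by (rule polytime_foldl[where q = "[:1, 1:]"]) (intro pt_intros, simp, intro pt_intros assms, intro pt_intros)
  moreover have "foldl (\<lambda>acc y. y # acc) zs ys = rev ys @ zs" for ys zs :: "'b list"
    by (induction ys arbitrary: zs) auto
  ultimately show ?thesis by simp
qed

lemma polytime_foldr:
  assumes "polytime (\<lambda>z. f (fst z) (fst (snd z)) (snd (snd z)))"
    and "\<And>e acc y. sz (f e y acc) \<le> sz acc + poly q (sz e + sz y)"
    and "polytime l" "polytime a"
  shows "polytime (\<lambda>x. foldr (f x) (l x) (a x))"
proof -
  have "polytime (\<lambda>z. f (fst z) (snd (snd z)) (fst (snd z)))"
    using polytime_comp[OF assms(1), of "\<lambda>z. (fst z, snd (snd z), fst (snd z))"]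
    by (simp add: pt_intros)
  then have "polytime (\<lambda>x. foldl (\<lambda>acc y. f x y acc) (a x) (rev (l x)))"
    using assms by (intro polytime_foldl[where q = q]) (auto intro: pt_intros)
  then show ?thesis by (simp add: foldr_conv_foldl)
qed

lemma polytime_append [pt_intros]:
  fixes l r :: "'a::encodable \<Rightarrow> 'b::encodable list"
  assumes "polytime l" "polytime r" shows "polytime (\<lambda>x. l x @ r x)"
proof -
  have "polytime (\<lambda>x. foldr (\<lambda>y acc. y # acc) (l x) (r x))"
    by (rule polytime_foldr[where q = "[:1, 1:]"]) (intro pt_intros, simp, intro assms, intro assms)
  moreover have "foldr (\<lambda>y acc. y # acc) ys zs = ys @ zs" for ys zs :: "'b list"
    by (induction ys) auto
  ultimately show ?thesis by simp
qed

lemma polytime_map [pt_intros]: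
  fixes f :: "'a::encodable \<Rightarrow> 'b::encodable \<Rightarrow> 'c::encodable"
  assumes "polytime (\<lambda>z. f (fst z) (snd z))" "polytime l"
  shows "polytime (\<lambda>x. map (f x) (l x))"
proof -
  obtain q where q: "\<And>z. sz (f (fst z) (snd z)) \<le> poly q (sz z)"
    using polytime_sz[OF assms(1)] unfolding poly_bounded_def by blast
  have "polytime (\<lambda>z. f (fst z) (fst (snd z)))"
    using polytime_comp[OF assms(1), of "\<lambda>z. (fst z, fst (snd z))"] by (simp add: pt_intros)
  \<comment> \<open>\<open>[:1, 1:]\<close> accounts for the pair constructor in
    \<open>sz (e, y) = 1 + (sz e + sz y)\<close>, the final \<open>+ 1\<close> for the new list
    cell.\<close>
  moreover have "sz (f e y) + 1 \<le> poly (pcompose q [:1, 1:] + 1) (sz e + sz y)" for e y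
    using q[of "(e, y)"] by (simp add: poly_pcompose)
  ultimately have "polytime (\<lambda>x. foldr (\<lambda>y acc. f x y # acc) (l x) [])"
    using assms(2)
    by (intro polytime_foldr[where q = "pcompose q [:1, 1:] + 1"] pt_intros) (auto simp: add.commute)
  moreover have "foldr (\<lambda>y acc. g y # acc) ys [] = map g ys" for g :: "'b \<Rightarrow> 'c" and ys
    by (induction ys) auto
  ultimately show ?thesis by simp
qed

lemma polytime_tl [pt_intros]: "polytime l \<Longrightarrow> polytime (\<lambda>x. tl (l x))"
  unfolding tl_def by (intro polytime_case_list pt_intros)

lemma polytime_zip [pt_intros]:
  fixes l :: "'a::encodable \<Rightarrow> 'b::encodable list" and r :: "'a \<Rightarrow> 'c::encodable list"
  assumes "polytime l" "polytime r" shows "polytime (\<lambda>x. zip (l x) (r x))"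
proof -
  \<comment> \<open>The accumulator holds the unread part of the second list and the reversed
    result. Once the second list is exhausted nothing more is added, as in
    \<open>zip\<close>.\<close>
  define f :: "'a \<Rightarrow> 'c list \<times> ('b \<times> 'c) list \<Rightarrow> 'b \<Rightarrow> 'c list \<times> ('b \<times> 'c) list" where
    "f e acc y = (case fst acc of [] \<Rightarrow> acc | z # zs \<Rightarrow> (zs, (y, z) # snd acc))" for e acc y
  have "polytime (\<lambda>z. f (fst z) (fst (snd z)) (snd (snd z)))"
    unfolding f_def by (intro polytime_case_list pt_intros)
  moreover have "sz (f e acc y) \<le> sz acc + poly [:2, 1:] (sz e + sz y)" for e acc y
    by (cases acc; cases "fst acc") (auto simp: f_def)
  ultimately have "polytime (\<lambda>x. foldl (f x) (r x, []) (l x))"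
    using assms by (intro polytime_foldl pt_intros)
  then have "polytime (\<lambda>x. rev (snd (foldl (f x) (r x, []) (l x))))" by (intro pt_intros)
  moreover have "snd (foldl (f x) (zs, acc) ys) = rev (zip ys zs) @ acc" for x zs acc ys
    by (induction ys arbitrary: zs acc) (auto simp: f_def split: list.split)
  ultimately show ?thesis by simp
qed

text \<open>Counting down from \<open>g x - f x\<close> builds \<open>[0..<g x - f x]\<close> from
  its end, and a shift by \<open>f x\<close> finishes. The number of rounds is polynomial because
  numbers have unary size.\<close>

lemma polytime_upt [pt_intros]:
  assumes "polytime f" "polytime g" shows "polytime (\<lambda>x. [f x..<g x])"
proof -
  define step :: "nat \<times> nat list \<Rightarrow> nat \<times> nat list" where "step z = (fst z - 1, (fst z - 1) # snd z)" for z
  have step: "polytime step" unfolding step_def by (intro pt_intros)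
  have iter: "(step ^^ i) (k, l) = (k - i, [k - i..<k] @ l)" if "i \<le> k" for i k l
    using that
  proof (induction i)
    case (Suc i)
    then show ?case by (simp add: step_def upt_conv_Cons[of "k - Suc i"] Suc_diff_Suc)
  qed simp
  have "polytime (\<lambda>z. (step ^^ fst z) z)"
  proof (rule polytime_while[OF step, of fst "\<lambda>z. 2 * sz z + sz z * (sz z + 2) + 1"])
    show "poly_bounded (fst :: nat \<times> nat list \<Rightarrow> nat)"
      by (rule poly_bounded_le[OF poly_bounded_sz]) (auto simp: enc_prod_def)
    fix z :: "nat \<times> nat list" and i
    obtain k l where z: "z = (k, l)" by (cases z)
    show "sz ((step ^^ i) z) \<le> 2 * sz z + sz z * (sz z + 2) + 1" if "i \<le> fst z"
    proof -
      have "sz [k - i..<k] \<le> length [k - i..<k] * Suc k + 1" by (rule sz_list_le) auto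
      also have "length [k - i..<k] * Suc k \<le> sz z * (sz z + 2)" using z by (intro mult_mono) auto
      finally show ?thesis using that z sz_append[of "[k - i..<k]" l] by (simp add: iter)
    qed
    show "enc (fst ((step ^^ i) z)) \<noteq> Atom 0" if "i < fst z" using that z by (simp add: iter)
    show "enc (fst ((step ^^ fst z) z)) = Atom 0" using z by (simp add: iter)
  qed (intro pb_intros)
  from polytime_comp[OF this, of "\<lambda>x. (g x - f x, [])"]
  have "polytime (\<lambda>x. (step ^^ (g x - f x)) (g x - f x, []))" by (simp add: pt_intros assms)
  then have "polytime (\<lambda>x. map (\<lambda>i. i + f x) (snd ((step ^^ (g x - f x)) (g x - f x, []))))"
    by (intro pt_intros polytime_comp[OF assms(1)])
  moreover have "map (\<lambda>i. i + f x) [0..<g x - f x] = [f x..<g x]" for x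
    by (cases "f x \<le> g x") (simp_all add: map_add_upt)
  ultimately show ?thesis by (simp add: iter)
qed

section \<open>The algorithm\<close>

text \<open>This form uses only a fold and comparisons, so the closure rules above apply to
  it.\<close>

lemma apply_transps_foldr:
  fixes x :: nat
  shows "apply_transps ts x = foldr (\<lambda>p y. if y = fst p then snd p else if y = snd p then fst p else y) ts x"
  by (induction ts) (auto simp: transpose_def split: prod.splits)

text \<open>The default \<open>x\<close> makes the induced function fix every point without an
  entry, as a permutation of \<open>{1..n}\<close> must outside that set.\<close>

definition lookup :: "('a \<times> 'a) list \<Rightarrow> 'a \<Rightarrow> 'a" where
  "lookup ps x = foldr (\<lambda>p y. if x = fst p then snd p else y) ps x"

definition transps_of_word :: "nat list \<Rightarrow> (nat \<times> nat) list" where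
  "transps_of_word w = map (\<lambda>i. (i, Suc i)) w"

text \<open>A cycle is the product of the transpositions of its neighbouring entries, in the order
  of the list.\<close>

definition cycle_transps :: "nat list \<Rightarrow> (nat \<times> nat) list" where
  "cycle_transps cs = zip cs (tl cs)"

text \<open>The \<open>min n\<close> never changes a value when \<open>us\<close> permutes \<open>{1..n}\<close>; it keeps the growth of the
  accumulator polynomial on all inputs.\<close>

definition transp_decomp :: "nat \<Rightarrow> (nat \<times> nat) list \<Rightarrow> (nat \<times> nat) list" where
  "transp_decomp n us = foldl (\<lambda>ts m. ts @ [(m, min n (apply_transps (rev ts) (apply_transps us m)))]) []
     (rev [2..<Suc n])"

text \<open>Insertion sort on strands. The pairs are meant to be \<open>(k, f k)\<close> for
  descending \<open>k\<close>; undoing the word so far on \<open>f k\<close> gives the present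
  position of that strand.\<close>

definition reduced_word :: "(nat \<times> nat) list \<Rightarrow> nat list" where
  "reduced_word ps =
     foldl (\<lambda>w p. w @ [apply_transps (rev (transps_of_word w)) (snd p)..<fst p]) [] ps"

definition rotate_to :: "nat \<Rightarrow> nat list \<Rightarrow> nat list" where
  "rotate_to d cs = (let (post, pre) =
     foldr (\<lambda>y (post, pre). if y = d then (y # pre, []) else (post, y # pre)) cs ([], [])
   in post @ pre)"

text \<open>For the cycles \<alpha>, \<gamma> of the two lists and s = \<alpha> \<gamma>\<inverse>,
  the second list is rotated to c = \<gamma> \<alpha>\<inverse> e, the point with s c = e. It is
  found from the lists alone, so s need not be stored.\<close>

definition insert_cycles ::
  "nat list \<Rightarrow> nat list \<Rightarrow> nat \<Rightarrow> nat \<Rightarrow> nat list \<times> nat list \<Rightarrow> nat list \<times> nat list" where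
  "insert_cycles xs ys d e L = (case L of (L1, L2) \<Rightarrow>
     (xs @ rotate_to d L1,
      ys @ rotate_to (apply_transps (cycle_transps L2) (apply_transps (rev (cycle_transps L1)) e)) L2))"

text \<open>The points of \<open>{1..n}\<close> are inserted into two cycles in increasing order. A point \<open>u\<close> with a
  nontrivial transposition \<open>(u a)\<close> is kept pending, encoded as \<open>(u, a)\<close>, until the next such point
  arrives; \<open>(0, 0)\<close> means that no point is pending. The case \<open>a = v\<close> uses \<open>(u v)(v b) = (v b)(u b)\<close>.\<close>

fun cycles_step ::
  "(nat list \<times> nat list) \<times> (nat \<times> nat) \<Rightarrow> nat \<times> nat \<Rightarrow> (nat list \<times> nat list) \<times> (nat \<times> nat)" where
  "cycles_step (L, (v, b)) (u, a) =
    (if a = u then (insert_cycles [u] [u] 1 1 L, (v, b))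
     else if v = 0 then (L, (u, a))
     else if a = v then (insert_cycles [v, u] [u, v] b b L, (0, 0))
     else (insert_cycles [u, v] [v, u] a b L, (0, 0)))"

definition cycle_pair :: "(nat \<times> nat) list \<Rightarrow> nat list \<times> nat list" where
  "cycle_pair ts = fst (foldl cycles_step (([1], [1]), (0, 0)) (rev ts))"

section \<open>Polynomial time for the parts of the algorithm\<close>

lemma polytime_apply_transps [pt_intros]:
  fixes f :: "'a::encodable \<Rightarrow> nat"
  assumes "polytime ts" "polytime f" shows "polytime (\<lambda>x. apply_transps (ts x) (f x))"
  unfolding apply_transps_foldr
  by (rule polytime_foldr[where q = "[:0, 1:]"]) (auto intro!: pt_intros assms simp: enc_prod_def)

lemma polytime_lookup [pt_intros]:
  fixes ps :: "'a::encodable \<Rightarrow> (nat \<times> nat) list"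
  assumes "polytime ps" "polytime f" shows "polytime (\<lambda>x. lookup (ps x) (f x))"
  unfolding lookup_def
  by (rule polytime_foldr[where q = "[:0, 1:]"])
    (auto intro!: pt_intros assms polytime_comp[OF assms(2)] simp: enc_prod_def)

lemma polytime_transps_of_word [pt_intros]: 
  "polytime w \<Longrightarrow> polytime (\<lambda>x. transps_of_word (w x))"
  unfolding transps_of_word_def by (intro pt_intros)

lemma polytime_cycle_transps [pt_intros]: 
  "polytime w \<Longrightarrow> polytime (\<lambda>x. cycle_transps (w x))"
  unfolding cycle_transps_def by (intro pt_intros)

lemma polytime_transp_decomp [pt_intros]:
  assumes "polytime n" "polytime us" shows "polytime (\<lambda>x. transp_decomp (n x) (us x))"
proof -
  \<comment> \<open>With the pair itself as the environment of the fold, the growth is measured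
    against \<open>n\<close> and not against an input from which \<open>n\<close> is
    computed.\<close>
  have "polytime (\<lambda>z. transp_decomp (fst z) (snd z))"
    unfolding transp_decomp_def
  proof (rule polytime_foldl[where q = "[:3, 2:]"])
    fix e :: "nat \<times> (nat \<times> nat) list" and acc :: "(nat \<times> nat) list" and y
    show "sz (acc @ [(y, min (fst e) (apply_transps (rev acc) (apply_transps (snd e) y)))]) \<le>
        sz acc + poly [:3, 2:] (sz e + sz y)"
      using sz_append[of acc "[(y, min (fst e) (apply_transps (rev acc) (apply_transps (snd e) y)))]"]
      by (simp add: enc_prod_def)
  qed (intro pt_intros)+
  from polytime_comp[OF this polytime_Pair[OF assms]] show ?thesis by simp
qed

lemma polytime_reduced_word [pt_intros]:
  assumes "polytime ps" shows "polytime (\<lambda>x. reduced_word (ps x))"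
  unfolding reduced_word_def
proof (rule polytime_foldl[where q = "[:0, 0, 1:] + [:1, 1:]"])
  fix acc and y :: "nat \<times> nat" and e :: 'a
  let ?j = "apply_transps (rev (transps_of_word acc)) (snd y)"
  have "sz [?j..<fst y] \<le> length [?j..<fst y] * Suc (fst y) + 1" by (rule sz_list_le) auto
  also have "length [?j..<fst y] * Suc (fst y) \<le> (sz e + sz y) * (sz e + sz y)"
    by (intro mult_mono) (auto simp: enc_prod_def)
  finally show "sz (acc @ [?j..<fst y]) \<le> sz acc + poly ([:0, 0, 1:] + [:1, 1:]) (sz e + sz y)"
    using sz_append[of acc "[?j..<fst y]"] by (simp add: algebra_simps)
qed (intro pt_intros assms)+

lemma polytime_rotate_to [pt_intros]:
  assumes "polytime d" "polytime cs" shows "polytime (\<lambda>x. rotate_to (d x) (cs x))"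
proof -
  have "polytime (\<lambda>z. rotate_to (fst z) (snd z))"
    unfolding rotate_to_def Let_def case_prod_beta
    by (intro pt_intros; rule polytime_foldr[where q = "[:1, 1:]"])
      (auto intro!: pt_intros simp: enc_prod_def)
  from polytime_comp[OF this polytime_Pair[OF assms]] show ?thesis by simp
qed

lemma sz_rotate_to: "sz (rotate_to d cs) \<le> sz cs"
proof -
  let ?f = "\<lambda>y (post, pre). if y = d then (y # pre, []) else (post, y # pre)"
  \<comment> \<open>Two lists have two end markers, whence the \<open>+ 1\<close>; appending them
    removes one again.\<close>
  have "sz (fst (foldr ?f cs ([], []))) + sz (snd (foldr ?f cs ([], []))) \<le> sz cs + 1"
  proof (induction cs)
    case (Cons y cs)
    obtain post pre where "foldr ?f cs ([], []) = (post, pre)" by (cases "foldr ?f cs ([], [])")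
    then show ?case using Cons Suc_leI[OF weight_pos[of "enc post"]] by simp
  qed simp
  then show ?thesis
    using sz_append[of "fst (foldr ?f cs ([], []))" "snd (foldr ?f cs ([], []))"]
    by (simp add: rotate_to_def Let_def case_prod_beta)
qed

lemma polytime_insert_cycles:
  assumes "polytime xs" "polytime ys" "polytime d" "polytime e" "polytime L"
  shows "polytime (\<lambda>x. insert_cycles (xs x) (ys x) (d x) (e x) (L x))"
  unfolding insert_cycles_def case_prod_beta by (intro pt_intros assms)

lemma cycles_step_eq:
  "cycles_step z y = (if snd y = fst y then (insert_cycles [fst y] [fst y] 1 1 (fst z), snd z)
     else if fst (snd z) = 0 then (fst z, y)
     else if snd y = fst (snd z) then
       (insert_cycles [fst (snd z), fst y] [fst y, fst (snd z)] (snd (snd z)) (snd (snd z)) (fst z), (0, 0))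
     else (insert_cycles [fst y, fst (snd z)] [fst (snd z), fst y] (snd y) (snd (snd z)) (fst z), (0, 0)))"
  by (cases z; cases y) auto

lemma polytime_cycle_pair [pt_intros]:
  assumes "polytime ts" shows "polytime (\<lambda>x. cycle_pair (ts x))"
proof -
  \<comment> \<open>A pending point comes from the accumulator, not from the current entry, and is
    later copied into both cycles. The factor 3 pays for this in advance, so that the growth is
    bounded in terms of the current entry.\<close>
  define \<phi> :: "(nat list \<times> nat list) \<times> (nat \<times> nat) \<Rightarrow> nat" where
    "\<phi> z = sz (fst z) + 3 * sz (snd z)" for z
  have app: "sz (us @ rotate_to c vs) \<le> sz us + sz vs" for us c vs
    using sz_append[of us "rotate_to c vs"] sz_rotate_to[of c vs] by linarith
  have ins: "sz (insert_cycles xs ys d e L) \<le> sz L + sz xs + sz ys" for xs ys d e L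
    using add_mono[OF app[of xs d "fst L"] app[of ys "apply_transps (cycle_transps (snd L))
      (apply_transps (rev (cycle_transps (fst L))) e)" "snd L"]]
    by (simp add: insert_cycles_def case_prod_beta enc_prod_def)
  show ?thesis
    unfolding cycle_pair_def
  proof (intro pt_intros, rule polytime_foldl_potential[where \<phi> = \<phi> and q = "[:20, 10:]"])
    show "polytime (\<lambda>z :: 'a \<times> ((nat list \<times> nat list) \<times> (nat \<times> nat)) \<times> (nat \<times> nat).
        cycles_step (fst (snd z)) (snd (snd z)))"
      unfolding cycles_step_eq by (intro pt_intros polytime_insert_cycles)
    show "poly_bounded \<phi>" unfolding \<phi>_def by (intro pb_intros polytime_sz pt_intros)
    show "sz acc \<le> \<phi> acc" for acc
      using weight_pos[of "enc (snd acc)"] by (simp add: \<phi>_def enc_prod_def)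
    fix e :: 'a and acc :: "(nat list \<times> nat list) \<times> (nat \<times> nat)" and y :: "nat \<times> nat"
    show "\<phi> (cycles_step acc y) \<le> \<phi> acc + poly [:20, 10:] (sz e + sz y)"
      using ins[of "[fst y]" "[fst y]" 1 1 "fst acc"]
        ins[of "[fst (snd acc), fst y]" "[fst y, fst (snd acc)]" "snd (snd acc)" "snd (snd acc)" "fst acc"]
        ins[of "[fst y, fst (snd acc)]" "[fst (snd acc), fst y]" "snd y" "snd (snd acc)" "fst acc"]
      by (auto simp: cycles_step_eq \<phi>_def enc_prod_def[of "snd acc"] enc_prod_def[of y] enc_prod_def[of "(0,0)"])
  qed (intro pt_intros assms)+
qed

text \<open>The table \<open>zip L1 L2\<close> is the permutation that conjugates the first cycle
  into the second. The points \<open>ms\<close> descend because \<open>reduced_word\<close> settles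
  the last position first.\<close>

definition commutator_words_of :: "nat \<Rightarrow> nat list \<Rightarrow> nat list \<times> nat list" where
  "commutator_words_of n w = (let
     (L1, L2) = cycle_pair (transp_decomp n (transps_of_word w));
     ms = rev [1..<Suc n]
   in (reduced_word (map (\<lambda>m. (m, apply_transps (cycle_transps L1) m)) ms),
       reduced_word (map (\<lambda>m. (m, lookup (zip L1 L2) m)) ms)))"

text \<open>Since the inverse of [d1, d2] is [d2, d1], the first word represents b times the inverse
  of [d1, d2].\<close>

definition factorisation :: "nat \<Rightarrow> letter list \<Rightarrow> letter list \<times> letter list \<times> letter list" where
  "factorisation n b = (let (d1, d2) = commutator_words_of n (map index b)
   in (b @ map Gen d2 @ map Gen d1 @ rev (map GenInv d2) @ rev (map GenInv d1), map Gen d1, map Gen d2))"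

lemma polytime_factorisation: "polytime (\<lambda>(n, b). factorisation n b)"
  unfolding factorisation_def commutator_words_of_def Let_def case_prod_beta
  by (intro pt_intros)

section \<open>Even permutations as quotients of two cycles\<close>

lemma bij_apply_transps: "bij (apply_transps ts)"
  by (rule permutation_bijective[OF permutation_apply_transps])

lemma apply_transps_rev_apply [simp]: "apply_transps (rev ts) (apply_transps ts x) = x"
proof (induction ts arbitrary: x)
  case (Cons t ts)
  then show ?case by (cases t) (simp add: apply_transps_append)
qed simp

lemma apply_transps_apply_rev [simp]: "apply_transps ts (apply_transps (rev ts) x) = x"
  using apply_transps_rev_apply[of "rev ts" x] by simp

lemma apply_cycle_transps [simp]: "apply_transps (cycle_transps cs) = cycle_of_list cs"
  unfolding cycle_transps_def by (induction cs rule: cycle_of_list.induct) auto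

lemma apply_transps_of_word [simp]: "apply_transps (transps_of_word w) = word_perm w"
  unfolding transps_of_word_def by (induction w) auto

lemma evenperm_word_perm: "evenperm (word_perm w) \<longleftrightarrow> even (length w)"
proof -
  have "\<forall>(a, b) \<in> set (transps_of_word w). a \<noteq> b" by (auto simp: transps_of_word_def)
  from evenperm_apply_transps_iff[OF this] show ?thesis by (simp add: transps_of_word_def flip: apply_transps_of_word)
qed

lemma evenperm_cycle_of_list:
  fixes cs :: "nat list"
  assumes "distinct cs" shows "evenperm (cycle_of_list cs) \<longleftrightarrow> even (length cs - 1)"
proof -
  have "a \<noteq> b" if "(a, b) \<in> set (cycle_transps cs)" for a b
    using that assms unfolding cycle_transps_def
    by (auto simp: set_zip nth_tl nth_eq_iff_index_eq)
  then have "\<forall>(a, b) \<in> set (cycle_transps cs). a \<noteq> b" by auto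
  from evenperm_apply_transps_iff[OF this] show ?thesis
    by (simp add: cycle_transps_def[of cs] flip: apply_cycle_transps)
qed

lemma comp_transpose: "inj s \<Longrightarrow> s \<circ> transpose x y = transpose (s x) (s y) \<circ> s"
  by (auto simp: fun_eq_iff transpose_def inj_eq)

section \<open>Inserting points into a pair of cycles\<close>

lemma rotate_to_split:
  assumes "d \<notin> set xs" "d \<notin> set ys" shows "rotate_to d (xs @ d # ys) = d # ys @ xs"
proof -
  let ?f = "\<lambda>y (post, pre). if y = d then (y # pre, []) else (post, y # pre)"
  have "foldr ?f zs (post, pre) = (post, zs @ pre)" if "d \<notin> set zs" for zs post pre
    using that by (induction zs) auto
  then show ?thesis using assms by (simp add: rotate_to_def)
qed

lemma rotate_to_cycle:
  assumes "distinct cs" "d \<in> set cs"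
  obtains ds where "rotate_to d cs = d # ds" "distinct (d # ds)" "set (d # ds) = set cs"
    "cycle_of_list (d # ds) = cycle_of_list cs"
proof -
  obtain xs ys where cs: "cs = xs @ d # ys" using assms(2) by (meson split_list)
  with assms have nin: "d \<notin> set xs" "d \<notin> set ys" by auto
  have "rotate (length xs) cs = d # ys @ xs" by (simp add: cs rotate_append)
  then have "cycle_of_list (d # ys @ xs) = cycle_of_list cs"
    using cycle_of_list_rotate_independent[OF assms(1), of "length xs"] by simp
  with rotate_to_split[OF nin] show ?thesis
    using assms(1) by (intro that[of "ys @ xs"]) (auto simp: cs)
qed

text \<open>This is s = \<alpha> \<gamma>\<inverse> with the inverse cleared. Prepending entries to
  the lists then just composes both cycles with transpositions from the left.\<close>

definition cycle_quotient ::
  "nat list \<times> nat list \<Rightarrow> nat set \<Rightarrow> (nat \<Rightarrow> nat) \<Rightarrow> bool" where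
  "cycle_quotient L M s \<longleftrightarrow> distinct (fst L) \<and> distinct (snd L) \<and> set (fst L) = M \<and> set (snd L) = M \<and>
     s \<circ> cycle_of_list (snd L) = cycle_of_list (fst L)"

text \<open>Multiplying by the inverse of the second cycle writes \<open>s\<close> as a product of
  permutations of \<open>M\<close>. In particular \<open>s\<close> fixes all points that are still
  to be inserted.\<close>

lemma cycle_quotient_permutes:
  assumes "cycle_quotient L M s" shows "s permutes M"
proof -
  let ?c = "cycle_of_list (snd L)"
  have "s = s \<circ> ?c \<circ> inv' ?c"
    by (metis bij_is_surj comp_assoc comp_id permutation_bijective permutation_of_cycle surj_iff)
  also have "\<dots> = cycle_of_list (fst L) \<circ> inv' ?c" using assms by (simp add: cycle_quotient_def)
  finally have "s = cycle_of_list (fst L) \<circ> inv' ?c" .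
  moreover have "cycle_of_list (fst L) \<circ> inv' ?c permutes M"
    using assms cycle_permutes[of "fst L"] cycle_permutes[of "snd L"]
    by (intro permutes_compose permutes_inv) (auto simp: cycle_quotient_def)
  ultimately show ?thesis by simp
qed

text \<open>Makes the heads \<open>d\<close> and \<open>c\<close> of the rotated lists explicit.
  Rotation does not change the cycles, so their quotient is still \<open>s\<close>.\<close>

lemma insert_cycles_aux:
  assumes q: "cycle_quotient L M s" and d: "d \<in> M" and e: "e \<in> M"
  obtains c ds cs where "insert_cycles xs ys d e L = (xs @ d # ds, ys @ c # cs)"
    "distinct (d # ds)" "distinct (c # cs)" "set (d # ds) = M" "set (c # cs) = M" "c \<in> M" "s c = e"
    "s \<circ> cycle_of_list (c # cs) = cycle_of_list (d # ds)"
proof -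
  obtain L1 L2 where L: "L = (L1, L2)" by (cases L)
  with q have L12: "distinct L1" "distinct L2" "set L1 = M" "set L2 = M"
    and s: "s \<circ> cycle_of_list L2 = cycle_of_list L1" by (auto simp: cycle_quotient_def)
  let ?e' = "apply_transps (rev (cycle_transps L1)) e"
  let ?c = "cycle_of_list L2 ?e'"
  have c: "s ?c = e"
    using fun_cong[OF s, of ?e'] apply_transps_apply_rev[of "cycle_transps L1" e] by simp
  then have "?c \<in> M" using e permutes_in_image[OF cycle_quotient_permutes[OF q], of ?c] by simp
  obtain ds where "rotate_to d L1 = d # ds" "distinct (d # ds)" "set (d # ds) = M"
    "cycle_of_list (d # ds) = cycle_of_list L1"
    using rotate_to_cycle[of L1 d] L12 d by metis
  moreover obtain cs where "rotate_to ?c L2 = ?c # cs" "distinct (?c # cs)" "set (?c # cs) = M"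
    "cycle_of_list (?c # cs) = cycle_of_list L2"
    using rotate_to_cycle[of L2 ?c] L12 \<open>?c \<in> M\<close> by metis
  ultimately show ?thesis
    using c \<open>?c \<in> M\<close> s by (intro that[of ds ?c cs]) (simp_all add: insert_cycles_def L)
qed

text \<open>Prepending \<open>m\<close> multiplies the cycles by (m d) and (m c) from the left. As s
  m = m and s c = d, moving s past (m c) turns it into (m d).\<close>

lemma cycle_quotient_insert1:
  assumes q: "cycle_quotient L M s" and d: "d \<in> M" and m: "m \<notin> M"
  shows "cycle_quotient (insert_cycles [m] [m] d d L) (insert m M) s"
proof -
  obtain c ds cs where *: "insert_cycles [m] [m] d d L = ([m] @ d # ds, [m] @ c # cs)"
    "distinct (d # ds)" "distinct (c # cs)" "set (d # ds) = M" "set (c # cs) = M" "s c = d"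
    "s \<circ> cycle_of_list (c # cs) = cycle_of_list (d # ds)"
    using insert_cycles_aux[OF q d d] by metis
  have s: "s m = m" "inj s"
    using cycle_quotient_permutes[OF q] m by (auto simp: permutes_not_in permutes_inj)
  have sw: "s \<circ> transpose m c = transpose m d \<circ> s"
    using comp_transpose[OF s(2), of m c] s(1) *(6) by simp
  have "s \<circ> (transpose m c \<circ> cycle_of_list (c # cs)) = transpose m d \<circ> (s \<circ> cycle_of_list (c # cs))"
    unfolding comp_assoc[symmetric] sw ..
  also have "\<dots> = transpose m d \<circ> cycle_of_list (d # ds)" by (simp only: *(7))
  finally have "s \<circ> cycle_of_list (m # c # cs) = cycle_of_list (m # d # ds)" by simp
  then show ?thesis using * m unfolding cycle_quotient_def by auto
qed

text \<open>Prepending turns \<gamma> into (v u)(u c)\<gamma> and \<alpha> into (u v)(v d)\<alpha>.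
  Since s fixes u and v, moving it past the two transpositions only replaces c by e.\<close>

lemma cycle_quotient_insert2:
  assumes q: "cycle_quotient L M s" and d: "d \<in> M" and e: "e \<in> M"
    and uv: "u \<notin> M" "v \<notin> M" "u \<noteq> v"
  shows "cycle_quotient (insert_cycles [u, v] [v, u] d e L) (insert u (insert v M))
    (transpose u d \<circ> transpose v e \<circ> s)"
proof -
  obtain c ds cs where *: "insert_cycles [u, v] [v, u] d e L = ([u, v] @ d # ds, [v, u] @ c # cs)"
    "distinct (d # ds)" "distinct (c # cs)" "set (d # ds) = M" "set (c # cs) = M" "s c = e"
    "s \<circ> cycle_of_list (c # cs) = cycle_of_list (d # ds)"
    using insert_cycles_aux[OF q d e] by metis
  have s: "s u = u" "s v = v" "inj s"
    using cycle_quotient_permutes[OF q] uv by (auto simp: permutes_not_in permutes_inj)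
  let ?c = "cycle_of_list (c # cs)"
  \<comment> \<open>Conjugation by (v u) exchanges (u e) with (v e) and (v d) with (u d). Two
    factors (v e) cancel, and both sides become (u d)(v u).\<close>
  have t: "transpose u d \<circ> transpose v e \<circ> (transpose v u \<circ> transpose u e) = transpose u v \<circ> transpose v d"
  proof -
    have "u \<noteq> d" "v \<noteq> d" "u \<noteq> e" "v \<noteq> e" using uv d e by auto
    then have "transpose v u \<circ> transpose u e = transpose v e \<circ> transpose v u"
      "transpose v u \<circ> transpose v d = transpose u d \<circ> transpose v u"
      using uv comp_transpose[of "transpose v u"] by (simp_all add: transpose_eq_iff)
    then show ?thesis by (metis comp_assoc comp_id transpose_comp_involutory transpose_commute)
  qed
  have sw: "s \<circ> transpose v u = transpose v u \<circ> s" "s \<circ> transpose u c = transpose u e \<circ> s"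
    using comp_transpose[OF s(3), of v u] comp_transpose[OF s(3), of u c] s(1,2) *(6) by simp_all
  have "s \<circ> (transpose v u \<circ> (transpose u c \<circ> ?c)) = (s \<circ> transpose v u) \<circ> (transpose u c \<circ> ?c)"
    by (simp only: comp_assoc)
  also have "\<dots> = transpose v u \<circ> ((s \<circ> transpose u c) \<circ> ?c)"
    unfolding sw(1) by (simp only: comp_assoc)
  also have "\<dots> = transpose v u \<circ> (transpose u e \<circ> (s \<circ> ?c))"
    unfolding sw(2) by (simp only: comp_assoc)
  finally have "s \<circ> (transpose v u \<circ> (transpose u c \<circ> ?c)) =
      (transpose v u \<circ> transpose u e) \<circ> cycle_of_list (d # ds)"
    unfolding *(7) by (simp only: comp_assoc)
  then have "transpose u d \<circ> transpose v e \<circ> s \<circ> (transpose v u \<circ> (transpose u c \<circ> ?c)) =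
     (transpose u v \<circ> transpose v d) \<circ> cycle_of_list (d # ds)"
    unfolding t[symmetric] by (simp only: comp_assoc)
  then have "transpose u d \<circ> transpose v e \<circ> s \<circ> cycle_of_list (v # u # c # cs) =
     cycle_of_list (u # v # d # ds)" by (simp add: comp_assoc)
  moreover have "distinct (u # v # d # ds)" "distinct (v # u # c # cs)"
    "set (u # v # d # ds) = insert u (insert v M)" "set (v # u # c # cs) = insert u (insert v M)"
    using *(2-5) uv by auto
  ultimately show ?thesis unfolding cycle_quotient_def *(1) by (simp only: append.simps fst_conv snd_conv)
qed

text \<open>While \<open>v\<close> is pending, the cycles omit it and its factor
  \<open>transpose v b\<close> is split off from \<open>s\<close>. The condition
  \<open>2 \<le> v\<close> keeps the point 1 in the cycles, next to which fixed points are
  inserted.\<close>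

definition cycles_invar ::
  "nat \<Rightarrow> (nat \<Rightarrow> nat) \<Rightarrow> (nat list \<times> nat list) \<times> (nat \<times> nat) \<Rightarrow> bool" where
  "cycles_invar k s z \<longleftrightarrow> (case z of (L, (v, b)) \<Rightarrow>
     if v = 0 then cycle_quotient L {1..k} s
     else 2 \<le> v \<and> v \<le> k \<and> b \<in> {1..k} - {v} \<and> cycle_quotient L ({1..k} - {v}) (transpose v b \<circ> s))"

lemma cycles_invar_step:
  assumes inv: "cycles_invar k s z" and k: "1 \<le> k" and a: "a \<in> {1..Suc k}"
  shows "cycles_invar (Suc k) (transpose (Suc k) a \<circ> s) (cycles_step z (Suc k, a))"
proof -
  obtain L v b where z: "z = (L, (v, b))" by (cases z) auto
  have ins: "insert (Suc k) {1..k} = {1..Suc k}" using k by auto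
  show ?thesis
  proof (cases "v = 0")
    case True
    then have q: "cycle_quotient L {1..k} s" using inv z by (simp add: cycles_invar_def)
    show ?thesis
    proof (cases "a = Suc k")
      case True
      have "cycle_quotient (insert_cycles [Suc k] [Suc k] 1 1 L) (insert (Suc k) {1..k}) s"
        by (rule cycle_quotient_insert1[OF q]) (use k in auto)
      then show ?thesis unfolding ins using True \<open>v = 0\<close> z by (simp add: cycles_invar_def)
    next
      case False
      moreover have "{1..Suc k} - {Suc k} = {1..k}" by auto
      moreover have "transpose (Suc k) a \<circ> (transpose (Suc k) a \<circ> s) = s"
        by (simp add: comp_assoc[symmetric])
      ultimately show ?thesis using q \<open>v = 0\<close> z a k by (auto simp: cycles_invar_def)
    qed
  next
    case False
    let ?M = "{1..k} - {v}" and ?s = "transpose v b \<circ> s"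
    have q: "cycle_quotient L ?M ?s" and v: "2 \<le> v" "v \<le> k" and b: "b \<in> ?M"
      using inv z False by (simp_all add: cycles_invar_def)
    have s: "s = transpose v b \<circ> ?s" by (simp add: comp_assoc[symmetric])
    have M: "insert (Suc k) (insert v ?M) = {1..Suc k}" using v by auto
    consider "a = Suc k" | "a = v" | "a \<in> ?M" using a by force
    then show ?thesis
    proof cases
      case 1
      have "cycle_quotient (insert_cycles [Suc k] [Suc k] 1 1 L) (insert (Suc k) ?M) ?s"
        by (rule cycle_quotient_insert1[OF q]) (use v in auto)
      moreover have "insert (Suc k) ?M = {1..Suc k} - {v}" using v by auto
      ultimately show ?thesis using 1 False z v b by (simp add: cycles_invar_def)
    next
      \<comment> \<open>The new point is paired with the pending one, which lies in neither cycle.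
        After rewriting, both transpositions meet the cycles in \<open>b\<close>.\<close>
      case 2
      have "cycle_quotient (insert_cycles [v, Suc k] [Suc k, v] b b L) (insert v (insert (Suc k) ?M))
         (transpose v b \<circ> transpose (Suc k) b \<circ> ?s)"
        by (rule cycle_quotient_insert2[OF q b b]) (use v in auto)
      moreover have "insert v (insert (Suc k) ?M) = {1..Suc k}" using M by auto
      moreover have "transpose v b \<circ> transpose (Suc k) b = transpose (Suc k) v \<circ> transpose v b"
        using v b by (auto simp: fun_eq_iff transpose_def)
      ultimately have "cycle_quotient (insert_cycles [v, Suc k] [Suc k, v] b b L) {1..Suc k}
         (transpose (Suc k) v \<circ> s)" using s by (simp only: comp_assoc)
      then show ?thesis using 2 False z v by (simp add: cycles_invar_def)
    next
      case 3
      have "cycle_quotient (insert_cycles [Suc k, v] [v, Suc k] a b L) (insert (Suc k) (insert v ?M))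
         (transpose (Suc k) a \<circ> transpose v b \<circ> ?s)"
        by (rule cycle_quotient_insert2[OF q 3 b]) (use v in auto)
      then have "cycle_quotient (insert_cycles [Suc k, v] [v, Suc k] a b L) {1..Suc k}
         (transpose (Suc k) a \<circ> s)" using s M by (simp only: comp_assoc)
      then show ?thesis using 3 False z v by (auto simp: cycles_invar_def)
    qed
  qed
qed

text \<open>Each step multiplies by its transposition from the left, so the pair processed last is
  the leftmost factor; hence \<open>rev us\<close>.\<close>

lemma cycles_invar_foldl:
  assumes "1 \<le> n" "map fst us = [2..<Suc n]" "\<forall>(m, a) \<in> set us. a \<in> {1..m}"
  shows "cycles_invar n (apply_transps (rev us)) (foldl cycles_step (([1], [1]), (0, 0)) us)"
  using assms
proof (induction n arbitrary: us rule: dec_induct)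
  case base
  then show ?case by (auto simp: cycles_invar_def cycle_quotient_def)
next
  case (step n)
  then have "map fst us = [2..<Suc n] @ [Suc n]" by simp
  then obtain ys x where us: "us = ys @ [x]" "map fst ys = [2..<Suc n]" "fst x = Suc n"
    by (cases us rule: rev_cases) auto
  then obtain a where x: "x = (Suc n, a)" by (cases x) auto
  have "cycles_invar n (apply_transps (rev ys)) (foldl cycles_step (([1], [1]), (0, 0)) ys)"
    using step us by auto
  from cycles_invar_step[OF this, of a] show ?case using step us x by (auto simp: o_def)
qed

text \<open>If a point \<open>v\<close> were left over, \<open>transpose v b \<circ> ?s\<close>
  would be a quotient of two cycles of equal length and thus even, which would make
  \<open>?s\<close> odd.\<close>

lemma cycle_pair_quotient:
  assumes "1 \<le> n" "map fst ts = rev [2..<Suc n]" "\<forall>(m, a) \<in> set ts. a \<in> {1..m}"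
    and even: "evenperm (apply_transps ts)"
  shows "cycle_quotient (cycle_pair ts) {1..n} (apply_transps ts)"
proof -
  let ?z = "foldl cycles_step (([1], [1]), (0, 0)) (rev ts)" and ?s = "apply_transps ts"
  obtain L v b where z: "?z = (L, (v, b))" by (metis prod.exhaust)
  have inv: "cycles_invar n ?s (L, (v, b))"
    using cycles_invar_foldl[of n "rev ts"] assms(1-3)
    by (simp only: z set_rev rev_rev_ident rev_map[symmetric])
  have "v = 0"
  proof (rule ccontr)
    assume v: "v \<noteq> 0"
    let ?r = "transpose v b \<circ> ?s"
    have q: "cycle_quotient L ({1..n} - {v}) ?r" and "v \<noteq> b" 
      using inv v by (auto simp: cycles_invar_def)
    have r: "permutation ?r" by (intro permutation_compose permutation_swap_id permutation_apply_transps)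
    have "length (fst L) = length (snd L)"
      using q unfolding cycle_quotient_def by (metis distinct_card)
    then have "evenperm (cycle_of_list (fst L)) = evenperm (cycle_of_list (snd L))"
      using q by (simp add: cycle_quotient_def evenperm_cycle_of_list)
    moreover have "evenperm (?r \<circ> cycle_of_list (snd L)) = evenperm (cycle_of_list (fst L))"
      using q by (simp only: cycle_quotient_def)
    ultimately have "evenperm ?r"
      using evenperm_comp[OF r permutation_of_cycle, of "snd L"] by auto
    moreover have "evenperm ?r = (evenperm (transpose v b) = evenperm ?s)"
      by (rule evenperm_comp[OF permutation_swap_id permutation_apply_transps])
    ultimately show False using even \<open>v \<noteq> b\<close> by (simp add: evenperm_swap)
  qed
  then show ?thesis using inv unfolding cycle_pair_def z by (simp add: cycles_invar_def)
qed

text \<open>If the remainder f permutes \<open>{1..m}\<close>, then a = f m is at most m, and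
  multiplying by (m a) from the left makes m a fixed point. The new remainder permutes the points
  below m.\<close>

lemma transp_decomp_aux:
  assumes f: "apply_transps us permutes {1..n}" and "k \<le> n"
  defines "ts \<equiv> foldl (\<lambda>ts m. ts @ [(m, min n (apply_transps (rev ts) (apply_transps us m)))]) []
     (rev [Suc k..<Suc n])"
  shows "map fst ts = rev [Suc k..<Suc n] \<and> (\<forall>(m, a) \<in> set ts. a \<in> {1..m}) \<and>
    apply_transps (rev ts) \<circ> apply_transps us permutes {1..k}"
  using \<open>k \<le> n\<close> unfolding ts_def
proof (induction k rule: inc_induct)
  case base
  then show ?case using f by simp
next
  case (step k)
  let ?F = "foldl (\<lambda>ts m. ts @ [(m, min n (apply_transps (rev ts) (apply_transps us m)))]) []"
  obtain ts where ts: "?F (rev [Suc (Suc k)..<Suc n]) = ts" by blast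
  let ?f = "apply_transps (rev ts) \<circ> apply_transps us"
  have IH: "map fst ts = rev [Suc (Suc k)..<Suc n]" "\<forall>(m, a) \<in> set ts. a \<in> {1..m}"
    "?f permutes {1..Suc k}"
    using step.IH unfolding ts by blast+
  obtain a where a: "?f (Suc k) = a" by blast
  have a_in: "a \<in> {1..Suc k}" using permutes_in_image[OF IH(3), of "Suc k"] a by simp
  then have "min n a = a" using step.hyps by auto
  moreover have upt: "rev [Suc k..<Suc n] = rev [Suc (Suc k)..<Suc n] @ [Suc k]"
    using step.hyps by (simp add: upt_conv_Cons)
  ultimately have ts': "?F (rev [Suc k..<Suc n]) = ts @ [(Suc k, a)]"
    using a by (simp add: ts del: upt_Suc)
  have "transpose (Suc k) a \<circ> ?f permutes {1..k}"
  proof (rule permutes_superset)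
    show "transpose (Suc k) a \<circ> ?f permutes {1..Suc k}"
      by (rule permutes_compose[OF IH(3) permutes_swap_id]) (use a_in in auto)
    show "(transpose (Suc k) a \<circ> ?f) x = x" if "x \<in> {1..Suc k} - {1..k}" for x
    proof -
      have "x = Suc k" using that by auto
      then show ?thesis using a by simp
    qed
  qed
  moreover have "apply_transps (rev (ts @ [(Suc k, a)])) \<circ> apply_transps us = transpose (Suc k) a \<circ> ?f"
    by (simp add: comp_assoc)
  ultimately have "apply_transps (rev (ts @ [(Suc k, a)])) \<circ> apply_transps us permutes {1..k}"
    by (simp only:)
  moreover have "map fst (ts @ [(Suc k, a)]) = rev [Suc k..<Suc n]"
    using IH(1) upt by (simp del: upt_Suc)
  moreover have "\<forall>(m, a) \<in> set (ts @ [(Suc k, a)]). a \<in> {1..m}" using IH(2) a_in by simp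
  ultimately show ?case unfolding ts' by blast
qed

lemma transp_decomp_correct:
  assumes f: "apply_transps us permutes {1..n}" and n: "1 \<le> n"
  shows "map fst (transp_decomp n us) = rev [2..<Suc n]"
    "\<forall>(m, a) \<in> set (transp_decomp n us). a \<in> {1..m}"
    "apply_transps (transp_decomp n us) = apply_transps us"
proof -
  let ?ts = "transp_decomp n us"
  \<comment> \<open>The descent can end at 2, because the only permutation of \<open>{1..1}\<close>
    is the identity.\<close>
  have *: "map fst ?ts = rev [2..<Suc n] \<and> (\<forall>(m, a) \<in> set ?ts. a \<in> {1..m}) \<and>
    apply_transps (rev ?ts) \<circ> apply_transps us permutes {1..1}"
    using transp_decomp_aux[OF f n] unfolding transp_decomp_def numeral_2_eq_2 One_nat_def .
  then show "map fst ?ts = rev [2..<Suc n]" "\<forall>(m, a) \<in> set ?ts. a \<in> {1..m}" by blast+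
  have "apply_transps (rev ?ts) \<circ> apply_transps us = id" using * by simp
  then have "apply_transps (rev ?ts) (apply_transps us x) = x" for x by (metis comp_apply id_apply)
  then show "apply_transps ?ts = apply_transps us" by (metis apply_transps_apply_rev ext)
qed

section \<open>Reduced words\<close>

lemma crossing_pairs_append:
  "crossing_pairs p (u @ v) = crossing_pairs p u @ crossing_pairs (p \<circ> word_perm u) v"
  by (induction u arbitrary: p) (auto simp: comp_assoc)

text \<open>The block carries one strand \<open>p j\<close> along, so this strand takes part in
  every crossing.\<close>

lemma crossing_pairs_upt: "crossing_pairs p [j..<k] = map (\<lambda>i. {p j, p (Suc i)}) [j..<k]"
proof (induction "k - j" arbitrary: p j)
  case (Suc d)
  then have "[j..<k] = j # [Suc j..<k]" by (simp add: upt_conv_Cons)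
  moreover have "crossing_pairs (p \<circ> transpose j (Suc j)) [Suc j..<k] =
      map (\<lambda>i. {(p \<circ> transpose j (Suc j)) (Suc j), (p \<circ> transpose j (Suc j)) (Suc i)}) [Suc j..<k]"
    using Suc by simp
  moreover have "\<dots> = map (\<lambda>i. {p j, p (Suc i)}) [Suc j..<k]"
    by (rule map_cong) (auto simp: transpose_def)
  ultimately show ?case by simp
qed simp

lemma word_perm_upt: "j \<le> k \<Longrightarrow> word_perm [j..<k] k = j"
  by (induction j rule: inc_induct) (auto simp: upt_conv_Cons)

lemma bij_word_perm: "bij (word_perm w)"
  using bij_apply_transps[of "transps_of_word w"] by simp

lemma reduced_word_snoc:
  "reduced_word (ps @ [(k, x)]) =
     reduced_word ps @ [apply_transps (rev (transps_of_word (reduced_word ps))) x..<k]"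
  by (simp add: reduced_word_def)

text \<open>The block \<open>[j..<k]\<close> moves the strand \<open>f k\<close> from position \<open>j\<close> to its final position \<open>k\<close>. All
  crossings of the block involve this strand, and no later crossing does.\<close>

lemma reduced_word_aux:
  assumes f: "f permutes {1..n}" and "k \<le> n"
  defines "w \<equiv> reduced_word (map (\<lambda>m. (m, f m)) (rev [Suc k..<Suc n]))"
  shows "w \<in> perm_words n \<and> (\<exists>g. g permutes {1..k} \<and> word_perm w \<circ> g = f) \<and>
    distinct (crossing_pairs id w) \<and> (\<forall>P \<in> set (crossing_pairs id w). \<exists>m \<in> {k<..n}. f m \<in> P)"
  using \<open>k \<le> n\<close> unfolding w_def
proof (induction k rule: inc_induct)
  case base
  then show ?case using f by (auto simp: reduced_word_def perm_words_def)
next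
  case (step k)
  let ?k = "Suc k"
  obtain u where u: "reduced_word (map (\<lambda>m. (m, f m)) (rev [Suc ?k..<Suc n])) = u" by blast
  let ?q = "word_perm u"
  obtain g where w: "u \<in> perm_words n" and g: "g permutes {1..?k}" "?q \<circ> g = f"
    and dist: "distinct (crossing_pairs id u)"
    and old: "\<forall>P \<in> set (crossing_pairs id u). \<exists>m \<in> {?k<..n}. f m \<in> P"
    using step.IH unfolding u by blast
  have q: "inj ?q" using bij_word_perm bij_is_inj by blast
  \<comment> \<open>\<open>g\<close> is the part still to be sorted: by
    \<open>?q \<circ> g = f\<close>, the strand \<open>f ?k\<close> currently sits at position
    \<open>g ?k\<close>.\<close>
  define j where "j = g ?k"
  have j: "1 \<le> j" "j \<le> ?k" using permutes_in_image[OF g(1), of ?k] by (auto simp: j_def)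
  have fk: "?q j = f ?k" unfolding j_def by (rule fun_cong[OF g(2), unfolded o_apply])
  have "apply_transps (rev (transps_of_word u)) (f ?k) = j"
    using apply_transps_rev_apply[of "transps_of_word u" j] fk by simp
  moreover have "map (\<lambda>m. (m, f m)) (rev [?k..<Suc n]) =
      map (\<lambda>m. (m, f m)) (rev [Suc ?k..<Suc n]) @ [(?k, f ?k)]"
    using step.hyps by (simp add: upt_conv_Cons[of "Suc k"] del: upt_Suc)
  ultimately have w': "reduced_word (map (\<lambda>m. (m, f m)) (rev [?k..<Suc n])) = u @ [j..<?k]"
    by (simp only: reduced_word_snoc u)
  let ?c = "word_perm [j..<?k]"
  have c: "?c permutes {1..?k}"
    by (rule word_perm_permutes) (use j in \<open>auto simp: perm_words_def\<close>)
  have "inv' ?c j = ?k" using word_perm_upt[OF j(2)] permutes_inv_eq[OF c] by simp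
  then have fix_k: "(inv' ?c \<circ> g) ?k = ?k" by (simp add: j_def)
  have g': "inv' ?c \<circ> g permutes {1..k}"
  proof (rule permutes_superset)
    show "inv' ?c \<circ> g permutes {1..?k}" by (rule permutes_compose[OF g(1) permutes_inv[OF c]])
    show "(inv' ?c \<circ> g) x = x" if "x \<in> {1..?k} - {1..k}" for x
    proof -
      have "x = ?k" using that by auto
      then show ?thesis by (simp only: fix_k)
    qed
  qed
  have "?q \<circ> ?c \<circ> (inv' ?c \<circ> g) = ?q \<circ> ((?c \<circ> inv' ?c) \<circ> g)" by (simp only: comp_assoc)
  also have "\<dots> = f" unfolding permutes_inv_o(1)[OF c] id_comp g(2) ..
  finally have word_eq: "word_perm (u @ [j..<?k]) \<circ> (inv' ?c \<circ> g) = f" unfolding word_perm_append .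
  have word: "\<exists>g. g permutes {1..k} \<and> word_perm (u @ [j..<?k]) \<circ> g = f"
    by (rule exI[of _ "inv' ?c \<circ> g"], rule conjI[OF g' word_eq])
  have perm: "u @ [j..<?k] \<in> perm_words n"
    using w j step.hyps by (auto simp: perm_words_def)
  have new: "crossing_pairs id (u @ [j..<?k]) =
      crossing_pairs id u @ map (\<lambda>i. {f ?k, ?q (Suc i)}) [j..<?k]"
    by (simp add: crossing_pairs_append crossing_pairs_upt fk del: upt_Suc)
  have dist_new: "distinct (map (\<lambda>i. {f ?k, ?q (Suc i)}) [j..<?k])"
    unfolding distinct_map
  proof (intro conjI distinct_upt inj_onI)
    fix a b assume "{f ?k, ?q (Suc a)} = {f ?k, ?q (Suc b)}"
    then have "?q (Suc a) = ?q (Suc b)" by (auto simp: doubleton_eq_iff)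
    then show "a = b" using q by (simp add: inj_eq)
  qed
  \<comment> \<open>An old pair contains some \<open>f m\<close> with \<open>m > ?k\<close>. As
    \<open>g\<close> fixes \<open>m\<close>, this strand sits at position \<open>m\<close>, whereas
    both strands of a new pair sit at positions up to \<open>?k\<close>.\<close>
  have disj: "{f ?k, ?q (Suc i)} \<notin> set (crossing_pairs id u)" if i: "i \<in> {j..<?k}" for i
  proof
    assume "{f ?k, ?q (Suc i)} \<in> set (crossing_pairs id u)"
    then obtain m where m: "m \<in> {?k<..n}" "f m \<in> {f ?k, ?q (Suc i)}" using old by blast
    have "f m \<noteq> f ?k" using m(1) permutes_inj[OF f] by (auto simp: inj_eq)
    moreover have "g m = m" using m(1) by (intro permutes_not_in[OF g(1)]) auto
    then have "f m = ?q m" using fun_cong[OF g(2), of m] by simp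
    then have "f m \<noteq> ?q (Suc i)" using q m(1) i by (auto simp: inj_eq)
    ultimately show False using m(2) by blast
  qed
  have dist': "distinct (crossing_pairs id (u @ [j..<?k]))"
    unfolding new distinct_append
  proof (intro conjI dist dist_new)
    show "set (crossing_pairs id u) \<inter> set (map (\<lambda>i. {f ?k, ?q (Suc i)}) [j..<?k]) = {}"
      using disj by (auto simp del: upt_Suc)
  qed
  have old': "\<exists>m \<in> {k<..n}. f m \<in> P" if "P \<in> set (crossing_pairs id (u @ [j..<?k]))" for P
    using that unfolding new
  proof (simp only: set_append Un_iff, elim disjE)
    assume "P \<in> set (crossing_pairs id u)"
    then obtain m where "m \<in> {?k<..n}" "f m \<in> P" using old by blast
    then show ?thesis by (intro bexI[of _ m]) auto
  next
    assume "P \<in> set (map (\<lambda>i. {f ?k, ?q (Suc i)}) [j..<?k])"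
    then show ?thesis using step.hyps by (intro bexI[of _ ?k]) auto
  qed
  show ?case unfolding w' by (rule conjI[OF perm conjI[OF word conjI[OF dist' ballI[OF old']]]])
qed

lemma reduced_word_correct:
  assumes f: "f permutes {1..n}"
  defines "w \<equiv> reduced_word (map (\<lambda>m. (m, f m)) (rev [1..<Suc n]))"
  shows "w \<in> perm_words n" "word_perm w = f" "distinct (crossing_pairs id w)"
proof -
  \<comment> \<open>At \<open>k = 0\<close> nothing is left to sort: a permutation of the empty set
    is the identity.\<close>
  have *: "w \<in> perm_words n \<and> (\<exists>g. g permutes {1..0} \<and> word_perm w \<circ> g = f) \<and>
    distinct (crossing_pairs id w) \<and> (\<forall>P \<in> set (crossing_pairs id w). \<exists>m \<in> {0<..n}. f m \<in> P)"
    using reduced_word_aux[OF f, of 0] unfolding w_def One_nat_def by blast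
  then obtain g where g: "g permutes {1..0}" "word_perm w \<circ> g = f" by blast
  have "g = id" using g(1) by simp
  then show "word_perm w = f" using g(2) by (simp only: comp_id)
  show "w \<in> perm_words n" "distinct (crossing_pairs id w)" using * by blast+
qed

section \<open>The factorisation\<close>

lemma lookup_zip_notin: "x \<notin> set xs \<Longrightarrow> lookup (zip xs ys) x = x"
  by (induction xs ys rule: list_induct2') (simp_all add: lookup_def)

lemma map_lookup_zip:
  assumes "length xs = length ys" "distinct xs" shows "map (lookup (zip xs ys)) xs = ys"
  using assms
proof (induction xs ys rule: list_induct2)
  case (Cons x xs y ys)
  have "map (lookup (zip (x # xs) (y # ys))) xs = map (lookup (zip xs ys)) xs"
    by (rule map_cong[OF refl]) (use Cons.prems in \<open>auto simp: lookup_def\<close>)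
  also have "\<dots> = ys" using Cons by simp
  finally show ?case by (simp only: list.map) (simp add: lookup_def)
qed simp

text \<open>The last equation is s = [\<alpha>, g] with the inverses cleared. Conjugation by g
  renames the entries of \<alpha> into those of \<gamma>, so g \<alpha> = \<gamma> g, and s \<gamma>
  = \<alpha> gives s g \<alpha> = s \<gamma> g = \<alpha> g.\<close>

lemma commutator_words_of_correct:
  assumes w: "w \<in> perm_words n" and n: "1 \<le> n" and even: "even (length w)"
    and d: "commutator_words_of n w = (d1, d2)"
  shows "d1 \<in> perm_words n" "d2 \<in> perm_words n"
    "distinct (crossing_pairs id d1)" "distinct (crossing_pairs id d2)"
    "word_perm w \<circ> word_perm d2 \<circ> word_perm d1 = word_perm d1 \<circ> word_perm d2"
proof -
  let ?ts = "transp_decomp n (transps_of_word w)"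
  obtain L1 L2 where L: "cycle_pair ?ts = (L1, L2)" by (cases "cycle_pair ?ts")
  have "apply_transps (transps_of_word w) permutes {1..n}" using word_perm_permutes[OF w] by simp
  note ts = transp_decomp_correct[OF this n]
  have "cycle_quotient (cycle_pair ?ts) {1..n} (apply_transps ?ts)"
    by (rule cycle_pair_quotient[OF n ts(1,2)]) (use ts(3) even in \<open>simp add: evenperm_word_perm\<close>)
  then have q: "distinct L1" "distinct L2" "set L1 = {1..n}" "set L2 = {1..n}"
    "word_perm w \<circ> cycle_of_list L2 = cycle_of_list L1"
    using ts(3) by (simp_all add: L cycle_quotient_def)
  have len: "length L1 = length L2" using q by (metis distinct_card)
  define g where "g = lookup (zip L1 L2)"
  have g1: "map g L1 = L2" "\<And>x. x \<notin> set L1 \<Longrightarrow> g x = x"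
    using map_lookup_zip[OF len q(1)] lookup_zip_notin by (simp_all add: g_def)
  have "g ` {1..n} = {1..n}" using g1(1) q(3,4) by (metis image_set)
  then have "bij_betw g {1..n} {1..n}" by (simp add: bij_betw_def finite_surj_inj)
  then have g: "g permutes {1..n}" using g1(2) q(3) by (intro bij_imp_permutes) auto
  have a: "cycle_of_list L1 permutes {1..n}" using cycle_permutes[of L1] q(3) by simp
  have d': "d1 = reduced_word (map (\<lambda>m. (m, cycle_of_list L1 m)) (rev [1..<Suc n]))"
    "d2 = reduced_word (map (\<lambda>m. (m, g m)) (rev [1..<Suc n]))"
    using d by (simp_all add: commutator_words_of_def L g_def Let_def del: upt_Suc)
  show "d1 \<in> perm_words n" "distinct (crossing_pairs id d1)"
    unfolding d' by (rule reduced_word_correct[OF a])+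
  show "d2 \<in> perm_words n" "distinct (crossing_pairs id d2)"
    unfolding d' by (rule reduced_word_correct[OF g])+
  have "g \<circ> cycle_of_list L1 \<circ> inv' g = cycle_of_list L2"
    using conjugation_of_cycle[OF q(1) permutes_bij[OF g]] g1(1) by simp
  then have "g \<circ> cycle_of_list L1 = cycle_of_list L2 \<circ> g"
    by (metis comp_assoc comp_id permutes_inv_o(2)[OF g])
  then have "word_perm w \<circ> g \<circ> cycle_of_list L1 = cycle_of_list L1 \<circ> g"
    using q(5) by (metis comp_assoc)
  then show "word_perm w \<circ> word_perm d2 \<circ> word_perm d1 = word_perm d1 \<circ> word_perm d2"
    unfolding d' reduced_word_correct(2)[OF a] reduced_word_correct(2)[OF g] .
qed

lemma braid_of_in_carrier: "w \<in> braid_words n \<Longrightarrow> braid_of n w \<in> carrier (braid_group n)"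
  by (simp add: braid_group_def)

lemma inv_braid_of:
  assumes "w \<in> braid_words n"
  shows "inv\<^bsub>braid_group n\<^esub> (braid_of n w) = braid_of n (inv_word w)"
proof (rule group.inv_equality[OF group_braid_group])
  have "braid_of n (inv_word w @ w) = braid_of n []"
    using inv_word_left[OF assms] by (simp add: braid_of_eq_iff)
  then show "braid_of n (inv_word w) \<otimes>\<^bsub>braid_group n\<^esub> braid_of n w = \<one>\<^bsub>braid_group n\<^esub>"
    by (simp add: braid_mult) (simp add: braid_group_def)
qed (use assms braid_words_inv in \<open>auto intro: braid_of_in_carrier\<close>)

text \<open>Braids with even permutation form a subgroup. It contains every commutator, because each
  of the two elements contributes its sign twice.\<close>

lemma commutator_word_even_length:
  assumes "b \<in> commutator_words n" shows "even (length b)"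
proof -
  let ?G = "braid_group n" and ?H = "{X \<in> carrier (braid_group n). evenperm (braid_perm X)}"
  interpret G: group ?G by (rule group_braid_group)
  interpret S: group "sym_group n" by (rule sym_group_is_group)
  interpret h: group_hom ?G "sym_group n" braid_perm
    by unfold_locales (rule braid_perm_hom)
  have perm: "permutation (braid_perm X)" if "X \<in> carrier ?G" for X
    using h.hom_closed[OF that] by (rule sym_group_carrier')
  have mult: "evenperm (braid_perm (X \<otimes>\<^bsub>?G\<^esub> Y)) \<longleftrightarrow> (evenperm (braid_perm X) = evenperm (braid_perm Y))"
    if "X \<in> carrier ?G" "Y \<in> carrier ?G" for X Y
    using that h.hom_mult perm by (simp add: sym_group_mult evenperm_comp)
  have inv: "evenperm (braid_perm (inv\<^bsub>?G\<^esub> X)) \<longleftrightarrow> evenperm (braid_perm X)"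
    if "X \<in> carrier ?G" for X
    using that h.hom_inv perm by (simp add: evenperm_inv)
  have "subgroup ?H ?G"
  proof (rule G.subgroupI)
    have "\<one>\<^bsub>?G\<^esub> \<in> ?H" by (simp add: sym_group_one)
    then show "?H \<noteq> {}" by blast
  qed (simp_all only: mem_Collect_eq mult inv G.inv_closed G.m_closed, simp)
  moreover have "derived_set ?G (carrier ?G) \<subseteq> ?H"
  proof
    fix Z assume "Z \<in> derived_set ?G (carrier ?G)"
    then obtain X Y where XY: "X \<in> carrier ?G" "Y \<in> carrier ?G"
      and Z: "Z = X \<otimes>\<^bsub>?G\<^esub> Y \<otimes>\<^bsub>?G\<^esub> inv\<^bsub>?G\<^esub> X \<otimes>\<^bsub>?G\<^esub> inv\<^bsub>?G\<^esub> Y" by blast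
    show "Z \<in> ?H"
      unfolding Z by (simp only: mem_Collect_eq mult inv G.inv_closed G.m_closed XY) blast
  qed
  ultimately have "derived ?G (carrier ?G) \<subseteq> ?H"
    unfolding derived_def by (rule G.generate_subgroup_incl[rotated])
  then have "evenperm (braid_perm (braid_of n b))"
    using assms by (auto simp: commutator_words_def)
  then show ?thesis by (simp add: braid_perm_braid_of evenperm_word_perm)
qed

lemma factorisation_correct:
  assumes b: "b \<in> commutator_words n" and n: "1 \<le> n" and F: "factorisation n b = (p, d\<^sub>1, d\<^sub>2)"
  shows "p \<in> braid_words n" "d\<^sub>1 \<in> braid_words n" "d\<^sub>2 \<in> braid_words n"
    "braid_of n p \<in> pure_braids n"
    "braid_of n d\<^sub>1 \<in> permutation_braids n" "braid_of n d\<^sub>2 \<in> permutation_braids n"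
    "braid_of n b = braid_of n p \<otimes>\<^bsub>braid_group n\<^esub>
       simple_commutator (braid_group n) (braid_of n d\<^sub>1) (braid_of n d\<^sub>2)"
proof -
  let ?G = "braid_group n"
  interpret G: group ?G by (rule group_braid_group)
  interpret S: group "sym_group n" by (rule sym_group_is_group)
  interpret h: group_hom ?G "sym_group n" braid_perm
    by unfold_locales (rule braid_perm_hom)
  let ?w = "map index b"
  have bw: "b \<in> braid_words n" using b by (simp add: commutator_words_def)
  then have w: "?w \<in> perm_words n" by (fastforce simp: braid_words_def perm_words_def)
  have even: "even (length ?w)" using commutator_word_even_length[OF b] by simp
  obtain e1 e2 where e: "commutator_words_of n ?w = (e1, e2)" by (metis prod.exhaust)
  note C = commutator_words_of_correct[OF w n even e]
  have p: "p = b @ d\<^sub>2 @ d\<^sub>1 @ inv_word d\<^sub>2 @ inv_word d\<^sub>1" and d: "d\<^sub>1 = map Gen e1" "d\<^sub>2 = map Gen e2"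
    using F by (auto simp: factorisation_def e inv_word_def)
  have Gen: "map Gen v \<in> braid_words n" if "v \<in> perm_words n" for v
    using that by (auto simp: braid_words_def perm_words_def)
  show dw: "d\<^sub>1 \<in> braid_words n" "d\<^sub>2 \<in> braid_words n" using Gen C(1,2) by (simp_all add: d)
  show pw: "p \<in> braid_words n"
    unfolding p by (intro braid_words_append bw dw braid_words_inv)
  show "braid_of n d\<^sub>1 \<in> permutation_braids n" "braid_of n d\<^sub>2 \<in> permutation_braids n"
    unfolding permutation_braids_def d using C(1-4) by (intro CollectI exI conjI; simp)+
  let ?B = "braid_of n b" and ?X = "braid_of n d\<^sub>1" and ?Y = "braid_of n d\<^sub>2" and ?P = "braid_of n p"
  have carr: "?B \<in> carrier ?G" "?X \<in> carrier ?G" "?Y \<in> carrier ?G" "?P \<in> carrier ?G"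
    using bw dw pw by (auto intro: braid_of_in_carrier)
  have P: "?P = ?B \<otimes>\<^bsub>?G\<^esub> (?Y \<otimes>\<^bsub>?G\<^esub> ?X \<otimes>\<^bsub>?G\<^esub> inv\<^bsub>?G\<^esub> ?Y \<otimes>\<^bsub>?G\<^esub> inv\<^bsub>?G\<^esub> ?X)"
    using dw by (simp add: p braid_mult inv_braid_of)
  have comm: "simple_commutator ?G ?X ?Y = inv\<^bsub>?G\<^esub> (?Y \<otimes>\<^bsub>?G\<^esub> ?X \<otimes>\<^bsub>?G\<^esub> inv\<^bsub>?G\<^esub> ?Y \<otimes>\<^bsub>?G\<^esub> inv\<^bsub>?G\<^esub> ?X)"
    using carr by (simp add: simple_commutator_def G.inv_mult_group G.m_assoc)
  show "?B = ?P \<otimes>\<^bsub>?G\<^esub> simple_commutator ?G ?X ?Y"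
    unfolding comm P using carr by (simp add: G.m_assoc)
  \<comment> \<open>Purity of the first factor: it equals \<open>?B ?Y ?X\<close> times the inverse
    of \<open>?X ?Y\<close>, and these two products have the same permutation.\<close>
  have e: "braid_perm (?B \<otimes>\<^bsub>?G\<^esub> ?Y \<otimes>\<^bsub>?G\<^esub> ?X) = braid_perm (?X \<otimes>\<^bsub>?G\<^esub> ?Y)"
    using C(5) by (simp add: braid_mult braid_perm_braid_of word_perm_append d comp_assoc o_def)
  have "?P = (?B \<otimes>\<^bsub>?G\<^esub> ?Y \<otimes>\<^bsub>?G\<^esub> ?X) \<otimes>\<^bsub>?G\<^esub> inv\<^bsub>?G\<^esub> (?X \<otimes>\<^bsub>?G\<^esub> ?Y)"
    using carr by (simp add: P G.inv_mult_group G.m_assoc)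
  then have "braid_perm ?P = braid_perm (?B \<otimes>\<^bsub>?G\<^esub> ?Y \<otimes>\<^bsub>?G\<^esub> ?X) \<otimes>\<^bsub>sym_group n\<^esub>
      braid_perm (inv\<^bsub>?G\<^esub> (?X \<otimes>\<^bsub>?G\<^esub> ?Y))"
    by (simp only:) (intro h.hom_mult G.m_closed G.inv_closed carr)
  also have "\<dots> = braid_perm (?X \<otimes>\<^bsub>?G\<^esub> ?Y) \<otimes>\<^bsub>sym_group n\<^esub>
      inv\<^bsub>sym_group n\<^esub> (braid_perm (?X \<otimes>\<^bsub>?G\<^esub> ?Y))"
    unfolding e by (subst h.hom_inv) (intro G.m_closed carr refl)+
  also have "\<dots> = \<one>\<^bsub>sym_group n\<^esub>" by (intro S.r_inv h.hom_closed G.m_closed carr)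
  finally have "braid_perm ?P = \<one>\<^bsub>sym_group n\<^esub>" .
  then show "?P \<in> pure_braids n" using carr by (simp add: pure_braids_def kernel_def)
qed

text \<open>Indices below \<open>n\<close> bound the unary size of each letter. The result is
  polynomial in \<open>n\<close> and in the length, so either of them can be held fixed as
  \<open>efficient\<close> demands.\<close>

lemma sz_braid_word:
  assumes "b \<in> braid_words n" shows "sz b \<le> length b * (n + 5) + 1"
proof -
  have "sz x \<le> n + 4" if "x \<in> set b" for x
  proof -
    have "index x < n" using assms that by (auto simp: braid_words_def)
    then show ?thesis by (cases x) auto
  qed
  then have "sz b \<le> length b * Suc (n + 4) + 1" by (rule sz_list_le)
  moreover have "Suc (n + 4) = n + 5" by simp
  ultimately show ?thesis by (simp only:)
qed

theorem corollary5p2p6: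
  fixes A :: com
  assumes A_efficient: "efficient perm_word_val perm_words A"
    and A_correct: "\<And>n w. n \<ge> 1 \<Longrightarrow> w \<in> perm_words n \<Longrightarrow>
      \<exists>v. canonical_form n (word_perm w) v \<and> outputs A n (perm_word_val w) (perm_word_val v)"
  shows "\<exists>P :: com. efficient braid_word_val commutator_words P \<and>
    (\<forall>n\<ge>1. \<forall>b \<in> commutator_words n.
      \<exists>p \<in> braid_words n. \<exists>d\<^sub>1 \<in> braid_words n. \<exists>d\<^sub>2 \<in> braid_words n.
        braid_of n p \<in> pure_braids n \<and>
        braid_of n d\<^sub>1 \<in> permutation_braids n \<and>
        braid_of n d\<^sub>2 \<in> permutation_braids n \<and>
        braid_of n b = braid_of n p \<otimes>\<^bsub>braid_group n\<^esub>
          simple_commutator (braid_group n) (braid_of n d\<^sub>1) (braid_of n d\<^sub>2) \<and>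
        outputs P n (braid_word_val b)
          (Pair (braid_word_val p) (Pair (braid_word_val d\<^sub>1) (braid_word_val d\<^sub>2))))"
proof -
  obtain call V T where sub: "subroutine (\<lambda>(n, b). factorisation n b) call V T"
    using polytime_subroutine[OF polytime_factorisation] by blast
  obtain r where r: "\<And>x. T x \<le> poly r (sz x)"
    using subroutineD(2)[OF sub] unfolding poly_bounded_def by blast
  \<comment> \<open>The argument expression joins the two inputs into the pair that the subroutine
    expects.\<close>
  let ?P = "call (MkPair (Var ''n'') (Var ''w''))"
  have enc_word: "braid_word_val b = enc b" for b by (simp add: enc_list_def enc_letter_def[abs_def])
  have run: "\<exists>t s. exec ?P (input_state n (braid_word_val b)) t s \<and> s ''out'' = enc (factorisation n b) \<and>
      t \<le> poly r (n + length b * (n + 5) + 3)" if "b \<in> braid_words n" for n b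
  proof -
    have "expr_val (MkPair (Var ''n'') (Var ''w'')) (input_state n (braid_word_val b)) = enc (n, b)"
      by (simp add: input_state_def enc_word)
    from subroutineE[OF sub this, unfolded prod.case] obtain t s where
      1: "exec ?P (input_state n (braid_word_val b)) t s" "s ''out'' = enc (factorisation n b)" "t \<le> T (n, b)" .
    have "sz (n, b) \<le> n + length b * (n + 5) + 3" using sz_braid_word[OF that] by simp
    then have "t \<le> poly r (n + length b * (n + 5) + 3)"
      using 1(3) r[of "(n, b)"] by (meson le_trans poly_nat_mono)
    with 1 show ?thesis by blast
  qed
  have halts: "halts_within ?P n (braid_word_val b) (poly r (n + length b * (n + 5) + 3))"
    if "b \<in> commutator_words n" for n b
    using run[of b n] that unfolding halts_within_def commutator_words_def by blast
  have "efficient braid_word_val commutator_words ?P"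
    unfolding efficient_def
  proof (intro conjI allI impI)
    fix k
    show "\<exists>p :: nat poly. \<forall>n\<ge>1. \<forall>w\<in>commutator_words n. length w = k \<longrightarrow>
        halts_within ?P n (braid_word_val w) (poly p n)"
    proof (intro exI allI ballI impI)
      fix n w assume "w \<in> commutator_words n" "length w = k"
      with halts have "halts_within ?P n (braid_word_val w) (poly r (n + k * (n + 5) + 3))" by blast
      \<comment> \<open>The common bound is read as a polynomial in \<open>n\<close>, with
        \<open>k\<close> absorbed into the coefficients.\<close>
      moreover have "poly (pcompose r ([:3, 1:] + smult k [:5, 1:])) n = poly r (n + k * (n + 5) + 3)"
        by (simp add: poly_pcompose algebra_simps)
      ultimately show "halts_within ?P n (braid_word_val w)
          (poly (pcompose r ([:3, 1:] + smult k [:5, 1:])) n)"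
        by (simp only:)
    qed
  next
    fix n :: nat
    show "\<exists>q :: nat poly. \<forall>w\<in>commutator_words n. halts_within ?P n (braid_word_val w) (poly q (length w))"
    proof (intro exI ballI)
      fix w assume "w \<in> commutator_words n"
      then have "halts_within ?P n (braid_word_val w) (poly r (n + length w * (n + 5) + 3))"
        by (rule halts)
      \<comment> \<open>The same bound is read as a polynomial in the length, now with
        \<open>n\<close> in the coefficients.\<close>
      moreover have "poly (pcompose r [:n + 3, n + 5:]) (length w) = poly r (n + length w * (n + 5) + 3)"
        by (simp add: poly_pcompose algebra_simps)
      ultimately show "halts_within ?P n (braid_word_val w) (poly (pcompose r [:n + 3, n + 5:]) (length w))"
        by (simp only:)
    qed
  qed
  moreover have "\<exists>p \<in> braid_words n. \<exists>d\<^sub>1 \<in> braid_words n. \<exists>d\<^sub>2 \<in> braid_words n.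
        braid_of n p \<in> pure_braids n \<and>
        braid_of n d\<^sub>1 \<in> permutation_braids n \<and>
        braid_of n d\<^sub>2 \<in> permutation_braids n \<and>
        braid_of n b = braid_of n p \<otimes>\<^bsub>braid_group n\<^esub>
          simple_commutator (braid_group n) (braid_of n d\<^sub>1) (braid_of n d\<^sub>2) \<and>
        outputs ?P n (braid_word_val b)
          (Pair (braid_word_val p) (Pair (braid_word_val d\<^sub>1) (braid_word_val d\<^sub>2)))"
    if n: "n \<ge> 1" and b: "b \<in> commutator_words n" for n b
  proof -
    obtain p d1 d2 where F: "factorisation n b = (p, d1, d2)" by (metis prod.exhaust)
    have "b \<in> braid_words n" using b by (simp add: commutator_words_def)
    from run[OF this] have "outputs ?P n (braid_word_val b) (enc (factorisation n b))"
      unfolding outputs_def by blast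
    then have "outputs ?P n (braid_word_val b)
        (Pair (braid_word_val p) (Pair (braid_word_val d1) (braid_word_val d2)))"
      by (simp only: F enc_simps enc_word)
    with factorisation_correct[OF b n F] show ?thesis by (intro bexI conjI)
  qed
  ultimately show ?thesis by blast
qed

end
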